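(* Let $\kappa$ be an inaccessible cardinal with $\kappa^+ = 2^{\kappa}$, and let $\mathfrak{U} = (\chi, \mathcal{S})$ be a universal algebra with $2 \leq |\chi| < \kappa$. Then there exists a homomorphic projection $\mathcal{E} \in \mathrm{End}(\mathfrak{U}^{\kappa}/\sim)$ (i.e. an endomorphism with $\mathcal{E}\circ\mathcal{E} = \mathcal{E}$) such that (1) the image of $\mathcal{E}$ is isomorphic to $\mathfrak{U}^{\kappa}/\sim$; and (2) for any $\Delta \in \mathrm{End}(\mathfrak{U}^{\kappa})$ with $\mathcal{E} \circ p_{\sim} = p_{\sim} \circ \Delta$ and for each cardinal $\lambda < \kappa$ we have $$|\{\alpha \in \kappa: \pi_{\alpha} \circ \Delta \text{ has no strong support of cardinality} \leq \lambda\}| = \kappa.$$ Additionally, if $\mathfrak{U}$ has a changing average, then $\mathcal{E}$ can be taken to satisfy (1), (2) and also (3) there exists $\sigma \in \mathfrak{U}^{\kappa}$ such that whenever $\tau \in \mathfrak{U}^{\kappa}$ satisfies $\mathcal{E}[\sigma]_{\sim} = [\tau]_{\sim}$ we have $|\{\alpha \in \kappa: \sigma(\alpha) = \tau(\alpha)\}| < \kappa$.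
   Context: Ordinals are sets of smaller ordinals. For $\sigma,\tau \in \mathfrak{U}^{\kappa}$ (functions $\kappa \to \chi$), $\sigma \sim \tau$ means $|\{\alpha \in \kappa : \sigma(\alpha) \neq \tau(\alpha)\}| < \kappa$ (eventual equality); this is a congruence, $\mathfrak{U}^{\kappa}/\sim$ is the quotient algebra and $p_{\sim}: \sigma \mapsto [\sigma]_{\sim}$ the quotient homomorphism. $\pi_\alpha:\mathfrak{U}^\kappa\to\mathfrak{U}$ is the $\alpha$-th coordinate projection. For a homomorphism $\Theta: \mathfrak{U}^{Z} \to \mathfrak{M}$, a subset $Y \subseteq Z$ is a strong support for $\Theta$ if (i) $\sigma \upharpoonright Y = \tau \upharpoonright Y$ implies $\Theta\sigma = \Theta\tau$, and (ii) for each $y \in Y$ and $\sigma \in \mathfrak{U}^{Z}$ there is $x \in \chi$ such that the function $\tau$ agreeing with $\sigma$ off $y$ and with $\tau(y) = x$ satisfies $\Theta\sigma \neq \Theta\tau$. A changing average is a homomorphism $\mathrm{Av}: \mathfrak{U} \times \mathfrak{U} \to \mathfrak{U}$ such that $\mathrm{Av}(x_0,x_1) = \mathrm{Av}(x_1,x_0)$ and $\mathrm{Av}(x_0,x_0) = x_0$ for all $x_0,x_1 \in \chi$, and there exist $x_2,x_3 \in \chi$ with $x_2 \neq \mathrm{Av}(x_2,x_3) \neq x_3$. *)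

theory Defs
  imports Main "HOL-Library.FuncSet"
begin

unbundle cardinal_syntax

text \<open>
  Cardinals are cardinal orders in the sense of the library; the ordinal \<open>\<kappa>\<close>, as the set of
  smaller ordinals, is \<open>Field \<kappa>\<close>. Every cardinal below \<open>\<kappa> :: 'k rel\<close> has a representative of
  type \<open>'k rel\<close>, so quantifying over that type loses nothing.
\<close>

definition inaccessible :: "'k rel \<Rightarrow> bool" where
  "inaccessible \<kappa> \<longleftrightarrow>
     Card_order \<kappa> \<and> natLeq <o \<kappa> \<and> regularCard \<kappa> \<and>
     (\<forall>\<mu> :: 'k rel. Card_order \<mu> \<and> \<mu> <o \<kappa> \<longrightarrow> ctwo ^c \<mu> <o \<kappa>)"


text \<open>
  The operations of an algebra are indexed by a set of symbols, so that they can be matched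
  across the algebras of one signature; an algebra \<open>(\<chi>, \<S>)\<close> given by a bare set of finitary
  operations is the case in which the symbols are the members of \<open>\<S>\<close>. Operations are
  relevant only on argument lists of the right length over the carrier.
\<close>

record ('f, 'a) ualg =
  carrier :: "'a set"
  symbols :: "'f set"
  arity :: "'f \<Rightarrow> nat"
  interp :: "'f \<Rightarrow> 'a list \<Rightarrow> 'a"

definition args :: "('f, 'a) ualg \<Rightarrow> 'f \<Rightarrow> 'a list set" where
  "args A f = {xs \<in> lists (carrier A). length xs = arity A f}"

definition ualgebra :: "('f, 'a) ualg \<Rightarrow> bool" where
  "ualgebra A \<longleftrightarrow> (\<forall>f \<in> symbols A. \<forall>xs \<in> args A f. interp A f xs \<in> carrier A)"

definition same_signature :: "('f, 'a) ualg \<Rightarrow> ('f, 'b) ualg \<Rightarrow> bool" where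
  "same_signature A B \<longleftrightarrow>
     symbols A = symbols B \<and> (\<forall>f \<in> symbols A. arity A f = arity B f)"

definition hom :: "('f, 'a) ualg \<Rightarrow> ('f, 'b) ualg \<Rightarrow> ('a \<Rightarrow> 'b) set" where
  "hom A B = {h \<in> carrier A \<rightarrow> carrier B.
     same_signature A B \<and>
     (\<forall>f \<in> symbols A. \<forall>xs \<in> args A f. h (interp A f xs) = interp B f (map h xs))}"

abbreviation End :: "('f, 'a) ualg \<Rightarrow> ('a \<Rightarrow> 'a) set" where
  "End A \<equiv> hom A A"

definition isomorphic :: "('f, 'a) ualg \<Rightarrow> ('f, 'b) ualg \<Rightarrow> bool" where
  "isomorphic A B \<longleftrightarrow> (\<exists>h \<in> hom A B. bij_betw h (carrier A) (carrier B))"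

definition image_alg :: "('f, 'b) ualg \<Rightarrow> ('a \<Rightarrow> 'b) \<Rightarrow> ('f, 'a) ualg \<Rightarrow> ('f, 'b) ualg" where
  "image_alg B h A = B\<lparr>carrier := h ` carrier A\<rparr>"

definition hom_projection :: "('f, 'a) ualg \<Rightarrow> ('a \<Rightarrow> 'a) \<Rightarrow> bool" where
  "hom_projection A e \<longleftrightarrow> e \<in> End A \<and> (\<forall>x \<in> carrier A. e (e x) = e x)"


definition prod_alg :: "('f, 'a) ualg \<Rightarrow> ('f, 'b) ualg \<Rightarrow> ('f, 'a \<times> 'b) ualg" where
  "prod_alg A B =
     \<lparr>carrier = carrier A \<times> carrier B, symbols = symbols A, arity = arity A,
      interp = (\<lambda>f ps. (interp A f (map fst ps), interp B f (map snd ps)))\<rparr>"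

definition power_alg :: "('f, 'a) ualg \<Rightarrow> 'i set \<Rightarrow> ('f, 'i \<Rightarrow> 'a) ualg" where
  "power_alg A Z =
     \<lparr>carrier = Z \<rightarrow>\<^sub>E carrier A, symbols = symbols A, arity = arity A,
      interp = (\<lambda>f \<sigma>s. \<lambda>z \<in> Z. interp A f (map (\<lambda>\<sigma>. \<sigma> z) \<sigma>s))\<rparr>"

text \<open>
  The value of an operation on a tuple of classes is the union, over all tuples of
  representatives, of the class of the value; for a congruence these classes all coincide
  (see \<open>interp_reduced_power\<close> below).
\<close>

definition quotient_alg :: "('f, 'a) ualg \<Rightarrow> 'a rel \<Rightarrow> ('f, 'a set) ualg" where
  "quotient_alg A R =
     \<lparr>carrier = carrier A // R, symbols = symbols A, arity = arity A,
      interp = (\<lambda>f Xs. \<Union>xs \<in> listset Xs. R `` {interp A f xs})\<rparr>"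

definition eventual_eq :: "('f, 'a) ualg \<Rightarrow> 'k rel \<Rightarrow> ('k \<Rightarrow> 'a) rel" where
  "eventual_eq A \<kappa> =
     {(\<sigma>, \<tau>). \<sigma> \<in> carrier (power_alg A (Field \<kappa>)) \<and> \<tau> \<in> carrier (power_alg A (Field \<kappa>)) \<and>
       |{\<alpha> \<in> Field \<kappa>. \<sigma> \<alpha> \<noteq> \<tau> \<alpha>}| <o \<kappa>}"

definition ev_class :: "('f, 'a) ualg \<Rightarrow> 'k rel \<Rightarrow> ('k \<Rightarrow> 'a) \<Rightarrow> ('k \<Rightarrow> 'a) set" where
  "ev_class A \<kappa> \<sigma> = eventual_eq A \<kappa> `` {\<sigma>}"

definition reduced_power :: "('f, 'a) ualg \<Rightarrow> 'k rel \<Rightarrow> ('f, ('k \<Rightarrow> 'a) set) ualg" where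
  "reduced_power A \<kappa> = quotient_alg (power_alg A (Field \<kappa>)) (eventual_eq A \<kappa>)"


definition strong_support ::
    "('f, 'a) ualg \<Rightarrow> 'i set \<Rightarrow> (('i \<Rightarrow> 'a) \<Rightarrow> 'b) \<Rightarrow> 'i set \<Rightarrow> bool" where
  "strong_support A Z \<Theta> Y \<longleftrightarrow>
     Y \<subseteq> Z \<and>
     (\<forall>\<sigma> \<in> carrier (power_alg A Z). \<forall>\<tau> \<in> carrier (power_alg A Z).
        restrict \<sigma> Y = restrict \<tau> Y \<longrightarrow> \<Theta> \<sigma> = \<Theta> \<tau>) \<and>
     (\<forall>y \<in> Y. \<forall>\<sigma> \<in> carrier (power_alg A Z). \<exists>x \<in> carrier A. \<Theta> \<sigma> \<noteq> \<Theta> (\<sigma>(y := x)))"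

definition changing_average :: "('f, 'a) ualg \<Rightarrow> ('a \<times> 'a \<Rightarrow> 'a) \<Rightarrow> bool" where
  "changing_average A Av \<longleftrightarrow>
     Av \<in> hom (prod_alg A A) A \<and>
     (\<forall>x\<^sub>0 \<in> carrier A. \<forall>x\<^sub>1 \<in> carrier A. Av (x\<^sub>0, x\<^sub>1) = Av (x\<^sub>1, x\<^sub>0)) \<and>
     (\<forall>x\<^sub>0 \<in> carrier A. Av (x\<^sub>0, x\<^sub>0) = x\<^sub>0) \<and>
     (\<exists>x\<^sub>2 \<in> carrier A. \<exists>x\<^sub>3 \<in> carrier A. x\<^sub>2 \<noteq> Av (x\<^sub>2, x\<^sub>3) \<and> Av (x\<^sub>2, x\<^sub>3) \<noteq> x\<^sub>3)"


lemma card_of_empty_less: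
  assumes "Cinfinite \<kappa>"
  shows "|{}| <o \<kappa>"
  using assms by (intro Cfinite_ordLess_Cinfinite)
    (auto simp: cfinite_def Field_card_of card_of_card_order_on)

lemma equiv_eventual_eq:
  assumes "Cinfinite \<kappa>"
  shows "equiv (carrier (power_alg A (Field \<kappa>))) (eventual_eq A \<kappa>)"
proof (rule equivI)
  show "refl_on (carrier (power_alg A (Field \<kappa>))) (eventual_eq A \<kappa>)"
    using card_of_empty_less[OF assms] by (auto simp: refl_on_def eventual_eq_def)
  show "eventual_eq A \<kappa> \<subseteq> carrier (power_alg A (Field \<kappa>)) \<times> carrier (power_alg A (Field \<kappa>))"
    by (auto simp: eventual_eq_def)
  show "sym (eventual_eq A \<kappa>)"
  proof (rule symI)
    fix \<sigma> \<tau> assume *: "(\<sigma>, \<tau>) \<in> eventual_eq A \<kappa>"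
    have "{\<alpha> \<in> Field \<kappa>. \<tau> \<alpha> \<noteq> \<sigma> \<alpha>} = {\<alpha> \<in> Field \<kappa>. \<sigma> \<alpha> \<noteq> \<tau> \<alpha>}"
      by metis
    with * show "(\<tau>, \<sigma>) \<in> eventual_eq A \<kappa>"
      by (simp add: eventual_eq_def)
  qed
  show "trans (eventual_eq A \<kappa>)"
  proof (rule transI)
    fix \<rho> \<sigma> \<tau> assume *: "(\<rho>, \<sigma>) \<in> eventual_eq A \<kappa>" "(\<sigma>, \<tau>) \<in> eventual_eq A \<kappa>"
    have "|{\<alpha> \<in> Field \<kappa>. \<rho> \<alpha> \<noteq> \<sigma> \<alpha>} \<union> {\<alpha> \<in> Field \<kappa>. \<sigma> \<alpha> \<noteq> \<tau> \<alpha>}| <o \<kappa>"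
      using * assms by (intro card_of_Un_ordLess_infinite_Field)
        (auto simp: eventual_eq_def cinfinite_def)
    then have "|{\<alpha> \<in> Field \<kappa>. \<rho> \<alpha> \<noteq> \<tau> \<alpha>}| <o \<kappa>"
      by (rule ordLeq_ordLess_trans[OF card_of_mono1, rotated]) auto
    then show "(\<rho>, \<tau>) \<in> eventual_eq A \<kappa>"
      using * by (auto simp: eventual_eq_def)
  qed
qed

lemma interp_power_in_carrier:
  assumes "ualgebra A" "f \<in> symbols A" "\<sigma>s \<in> args (power_alg A Z) f"
  shows "interp (power_alg A Z) f \<sigma>s \<in> carrier (power_alg A Z)"
proof -
  have "map (\<lambda>\<sigma>. \<sigma> z) \<sigma>s \<in> args A f" if "z \<in> Z" for z
    using assms(3) that by (auto simp: args_def power_alg_def in_lists_conv_set)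
  with assms(1,2) show ?thesis
    by (auto simp: ualgebra_def power_alg_def)
qed

lemma eventual_eq_congruence:
  assumes \<kappa>: "Cinfinite \<kappa>" and A: "ualgebra A" "f \<in> symbols A"
    and \<sigma>s: "\<sigma>s \<in> args (power_alg A (Field \<kappa>)) f"
    and rel: "list_all2 (\<lambda>\<sigma> \<tau>. (\<sigma>, \<tau>) \<in> eventual_eq A \<kappa>) \<sigma>s \<tau>s"
  shows "(interp (power_alg A (Field \<kappa>)) f \<sigma>s, interp (power_alg A (Field \<kappa>)) f \<tau>s)
    \<in> eventual_eq A \<kappa>"
proof -
  let ?P = "power_alg A (Field \<kappa>)"
  let ?D = "\<lambda>i. {\<alpha> \<in> Field \<kappa>. (\<sigma>s ! i) \<alpha> \<noteq> (\<tau>s ! i) \<alpha>}"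
  have len: "length \<sigma>s = length \<tau>s"
    using rel by (rule list_all2_lengthD)
  have nth: "(\<sigma>s ! i, \<tau>s ! i) \<in> eventual_eq A \<kappa>" if "i < length \<sigma>s" for i
    using list_all2_nthD[OF rel that] .
  have \<tau>s: "\<tau>s \<in> args ?P f"
  proof -
    have "\<tau>s ! i \<in> carrier ?P" if "i < length \<tau>s" for i
      using nth[of i] that len by (simp add: eventual_eq_def)
    then show ?thesis
      using \<sigma>s len by (auto simp: args_def in_lists_conv_set in_set_conv_nth)
  qed
  have D: "|\<Union>i<n. ?D i| <o \<kappa>" if "n \<le> length \<sigma>s" for n
    using that
  proof (induction n)
    case 0
    show ?case
      using card_of_empty_less[OF \<kappa>] by simp
  next
    case (Suc n)
    have "|(\<Union>i<n. ?D i) \<union> ?D n| <o \<kappa>"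
      using Suc nth[of n] \<kappa> by (intro card_of_Un_ordLess_infinite_Field)
        (auto simp: eventual_eq_def cinfinite_def)
    then show ?case
      by (simp add: lessThan_Suc Un_commute)
  qed
  have "{\<alpha> \<in> Field \<kappa>. interp ?P f \<sigma>s \<alpha> \<noteq> interp ?P f \<tau>s \<alpha>} \<subseteq> (\<Union>i<length \<sigma>s. ?D i)"
  proof (rule subsetI, rule ccontr)
    fix \<alpha> assume a: "\<alpha> \<in> {\<alpha> \<in> Field \<kappa>. interp ?P f \<sigma>s \<alpha> \<noteq> interp ?P f \<tau>s \<alpha>}"
      "\<alpha> \<notin> (\<Union>i<length \<sigma>s. ?D i)"
    then have "map (\<lambda>\<sigma>. \<sigma> \<alpha>) \<sigma>s = map (\<lambda>\<sigma>. \<sigma> \<alpha>) \<tau>s"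
      using len by (intro nth_equalityI) auto
    with a(1) show False
      by (simp add: power_alg_def split: if_splits)
  qed
  then have "|{\<alpha> \<in> Field \<kappa>. interp ?P f \<sigma>s \<alpha> \<noteq> interp ?P f \<tau>s \<alpha>}| <o \<kappa>"
    by (rule ordLeq_ordLess_trans[OF card_of_mono1 D[OF order_refl]])
  then show ?thesis
    using interp_power_in_carrier[OF A \<sigma>s] interp_power_in_carrier[OF A \<tau>s]
    by (simp add: eventual_eq_def)
qed

lemma in_listset_conv: "xs \<in> listset Xs \<longleftrightarrow> list_all2 (\<in>) xs Xs"
  by (induction Xs arbitrary: xs) (auto simp: set_Cons_def list_all2_Cons2)

lemma interp_reduced_power:
  assumes \<kappa>: "Cinfinite \<kappa>" and A: "ualgebra A" "f \<in> symbols A"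
    and \<sigma>s: "\<sigma>s \<in> args (power_alg A (Field \<kappa>)) f"
  shows "interp (reduced_power A \<kappa>) f (map (ev_class A \<kappa>) \<sigma>s) =
    ev_class A \<kappa> (interp (power_alg A (Field \<kappa>)) f \<sigma>s)"
proof -
  let ?P = "power_alg A (Field \<kappa>)"
  have eq: "equiv (carrier ?P) (eventual_eq A \<kappa>)"
    by (rule equiv_eventual_eq[OF \<kappa>])
  have cong: "ev_class A \<kappa> (interp ?P f \<tau>s) = ev_class A \<kappa> (interp ?P f \<sigma>s)"
    if "\<tau>s \<in> listset (map (ev_class A \<kappa>) \<sigma>s)" for \<tau>s
  proof -
    have "list_all2 (\<lambda>\<sigma> \<tau>. (\<sigma>, \<tau>) \<in> eventual_eq A \<kappa>) \<sigma>s \<tau>s"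
      using that by (auto simp: in_listset_conv list_all2_conv_all_nth ev_class_def)
    from eventual_eq_congruence[OF \<kappa> A \<sigma>s this] show ?thesis
      unfolding ev_class_def by (rule equiv_class_eq[OF eq, symmetric])
  qed
  have "\<sigma>s \<in> listset (map (ev_class A \<kappa>) \<sigma>s)"
    using \<sigma>s equiv_class_self[OF eq]
    by (auto simp: in_listset_conv list_all2_conv_all_nth ev_class_def args_def in_lists_conv_set)
  then have "(\<Union>\<tau>s \<in> listset (map (ev_class A \<kappa>) \<sigma>s). ev_class A \<kappa> (interp ?P f \<tau>s)) =
    ev_class A \<kappa> (interp ?P f \<sigma>s)"
    by (intro UN_constant_eq ballI cong)
  then show ?thesis
    by (simp add: reduced_power_def quotient_alg_def ev_class_def[of A \<kappa> "interp ?P f _"])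
qed

lemma ev_class_hom:
  assumes "Cinfinite \<kappa>" "ualgebra A"
  shows "ev_class A \<kappa> \<in> hom (power_alg A (Field \<kappa>)) (reduced_power A \<kappa>)"
proof -
  have "ev_class A \<kappa> \<in> carrier (power_alg A (Field \<kappa>)) \<rightarrow> carrier (reduced_power A \<kappa>)"
    by (auto simp: reduced_power_def quotient_alg_def ev_class_def intro: quotientI)
  moreover have "same_signature (power_alg A (Field \<kappa>)) (reduced_power A \<kappa>)"
    by (simp add: same_signature_def reduced_power_def quotient_alg_def)
  moreover have "symbols (power_alg A (Field \<kappa>)) = symbols A"
    by (simp add: power_alg_def)
  ultimately show ?thesis
    using assms by (auto simp: hom_def interp_reduced_power)
qed

end

theory Submission
  imports Defs
begin

text \<open>
  The heart of the proof is an endomorphism \<open>\<phi>\<close> of the reduced power that on every finite (even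
  \<open>\<kappa>\<close>-sized) set of classes is a substitution \<open>[s] \<mapsto> [s \<circ> \<theta>]\<close>, but not by one \<open>\<theta>\<close> globally. Cut \<open>\<kappa>\<close>
  into small but rapidly growing blocks \<open>B\<^sub>\<alpha>\<close>. By recursion of length \<open>2\<^sup>\<kappa> = \<kappa>\<^sup>+\<close> construct block-preserving
  maps \<open>\<theta>\<^sub>x\<close> moving at most \<open>|\<alpha>| + \<omega>\<close> points of \<open>B\<^sub>\<alpha>\<close>, where almost everywhere a later map agrees with
  an earlier one \<open>\<theta>\<^sub>x\<close> on the points moved by \<open>\<theta>\<^sub>x\<close>, and moves the other points only within the level sets
  of the function \<open>s\<^sub>x\<close> treated at stage \<open>x\<close>; so \<open>[s\<^sub>x \<circ> \<theta>\<^sub>y]\<close> does not depend on \<open>y \<ge> x\<close>. Limit stages of any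
  cofinality are harmless, because a point moved by no earlier map may simply stay where it is. As
  \<open>|B\<^sub>\<alpha>| > |\<chi>|\<^bsup>|\<alpha>| + \<omega>\<^esup>\<close>, every stage can in addition move in each block a point \<open>b\<close> to some point outside a
  prescribed small set \<open>R\<^sub>b\<close>, which defeats every assignment of strong supports of bounded size.

  Given a homomorphism \<open>M : \<UU> \<times> \<UU> \<rightarrow> \<UU>\<close> with \<open>M(x, x) = x\<close> (the first projection, or the changing average),
  split \<open>\<kappa>\<close> into three copies of itself and put \<open>\<E>(a, b, c) = (m, m, \<phi> m)\<close> with \<open>m = M(a, b)\<close>. This is \<open>J \<circ> A\<close>
  for \<open>A(a, b, c) = M(a, b)\<close> and \<open>J m = (m, m, \<phi> m)\<close>, and \<open>A \<circ> J = id\<close>.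
\<close>

section \<open>Small sets\<close>

lemma card_of_Pow_mono:
  assumes "|A| \<le>o |B|"
  shows "|Pow A| \<le>o |Pow B|"
proof -
  obtain f where f: "inj_on f A" "f ` A \<subseteq> B"
    using assms by (auto simp: card_of_ordLeq[symmetric])
  have "inj_on ((`) f) (Pow A)"
    using f(1) by (simp add: inj_on_image_Pow)
  moreover have "(`) f ` Pow A \<subseteq> Pow B"
    using f(2) by auto
  ultimately show ?thesis
    by (auto simp: card_of_ordLeq[symmetric])
qed

lemma card_of_PiE_ordLeq_Pow: "|A \<rightarrow>\<^sub>E B| \<le>o |Pow (A \<times> B)|"
proof -
  let ?graph = "\<lambda>f. {(a, f a) | a. a \<in> A}"
  have "inj_on ?graph (A \<rightarrow>\<^sub>E B)"
  proof (rule inj_onI)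
    fix f g assume fg: "f \<in> A \<rightarrow>\<^sub>E B" "g \<in> A \<rightarrow>\<^sub>E B" "?graph f = ?graph g"
    have "f a = g a" if "a \<in> A" for a
      using fg(3) that by blast
    then show "f = g"
      using fg(1,2) by (auto intro: PiE_ext)
  qed
  moreover have "?graph ` (A \<rightarrow>\<^sub>E B) \<subseteq> Pow (A \<times> B)"
    by auto
  ultimately show ?thesis
    by (auto simp: card_of_ordLeq[symmetric])
qed

locale inaccessible_cardinal =
  fixes \<kappa> :: "'k rel"
  assumes inaccessible: "inaccessible \<kappa>"
begin

abbreviation K :: "'k set" where "K \<equiv> Field \<kappa>"

definition small :: "'b set \<Rightarrow> bool" where "small X \<longleftrightarrow> |X| <o \<kappa>"

lemma Card_order: "Card_order \<kappa>"
  using inaccessible by (simp add: inaccessible_def)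

lemma Cinfinite: "Cinfinite \<kappa>"
proof
  show "cinfinite \<kappa>"
    using inaccessible cinfinite_mono[OF ordLess_imp_ordLeq natLeq_cinfinite]
    by (auto simp: inaccessible_def)
qed (rule Card_order)

lemma infinite_K: "infinite K"
  using Cinfinite by (simp add: cinfinite_def)

lemma card_of_K: "|K| =o \<kappa>"
  by (rule card_of_Field_ordIso[OF Card_order])

lemma not_small_K: "\<not> small K"
  using card_of_K not_ordLess_ordIso unfolding small_def by blast

lemma small_ordLeq: "\<lbrakk>small Y; |X| \<le>o |Y|\<rbrakk> \<Longrightarrow> small X"
  unfolding small_def by (rule ordLeq_ordLess_trans)

lemma small_mono: "\<lbrakk>small Y; X \<subseteq> Y\<rbrakk> \<Longrightarrow> small X"
  by (erule small_ordLeq) (rule card_of_mono1)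

lemma small_image: "small X \<Longrightarrow> small (f ` X)"
  by (erule small_ordLeq) (rule card_of_image)

lemma small_inj_on: "\<lbrakk>inj_on f X; f ` X \<subseteq> Y; small Y\<rbrakk> \<Longrightarrow> small X"
  by (erule small_ordLeq) (auto simp: card_of_ordLeq[symmetric])

lemma small_UN: "\<lbrakk>small I; \<And>i. i \<in> I \<Longrightarrow> small (X i)\<rbrakk> \<Longrightarrow> small (\<Union>i\<in>I. X i)"
  unfolding small_def using inaccessible Cinfinite
  by (intro card_of_UNION_ordLess_infinite_Field_regularCard ballI) (simp_all add: inaccessible_def)

lemma small_Un: "\<lbrakk>small X; small Y\<rbrakk> \<Longrightarrow> small (X \<union> Y)"
  using Un_Cinfinite_bound_strict Cinfinite unfolding small_def by blast

lemma small_finite: "finite X \<Longrightarrow> small X"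
  unfolding small_def using Cinfinite
  by (intro Cfinite_ordLess_Cinfinite) (auto simp: cfinite_def Field_card_of card_of_card_order_on)

lemma small_nat: "small (UNIV :: nat set)"
  using inaccessible card_of_nat ordIso_ordLess_trans unfolding small_def inaccessible_def by blast

lemma small_Sigma: "\<lbrakk>small I; \<And>i. i \<in> I \<Longrightarrow> small (X i)\<rbrakk> \<Longrightarrow> small (Sigma I X)"
  unfolding Sigma_def by (intro small_UN) (auto intro: small_finite)

lemma small_Plus: "\<lbrakk>small X; small Y\<rbrakk> \<Longrightarrow> small (X <+> Y)"
  unfolding Plus_def by (intro small_Un small_image)

lemma small_under: "\<alpha> \<in> K \<Longrightarrow> small (under \<kappa> \<alpha>)"
proof -
  assume "\<alpha> \<in> K"
  then have "small (underS \<kappa> \<alpha>)"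
    using card_of_underS[OF Card_order] by (simp add: small_def)
  then have "small (underS \<kappa> \<alpha> \<union> {\<alpha>})"
    by (rule small_Un) (simp add: small_finite)
  then show ?thesis
    by (rule small_mono) (auto simp: under_def underS_def)
qed

lemma small_Pow:
  assumes "small X"
  shows "small (Pow X)"
proof -
  \<comment> \<open>The strong limit hypothesis quantifies over cardinals on the type of \<kappa>,
    so \<open>X\<close> is first replaced by an equinumerous subset of \<open>K\<close>.\<close>
  obtain Y where Y: "Y \<subseteq> K" "|X| =o |Y|" "|Y| \<le>o \<kappa>"
    using assms internalize_card_of_ordLeq[of X \<kappa>] ordLess_imp_ordLeq
    unfolding small_def by blast
  have "|Y| <o \<kappa>"
    using Y(2) assms ordIso_ordLess_trans ordIso_symmetric unfolding small_def by blast
  then have "ctwo ^c |Y| <o \<kappa>"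
    using inaccessible card_of_Card_order[of Y] by (auto simp: inaccessible_def)
  moreover have "|Pow Y| =o ctwo ^c |Y|"
    unfolding cexp_def ctwo_def Field_card_of by (rule card_of_Pow_Func)
  ultimately have "small (Pow Y)"
    using ordIso_ordLess_trans unfolding small_def by blast
  then show ?thesis
    using Y(2) card_of_Pow_mono ordIso_iff_ordLeq small_ordLeq by blast
qed

lemma small_or_full: "X \<subseteq> K \<Longrightarrow> small X \<or> |X| =o \<kappa>"
  using card_of_mono1[of X K] card_of_K ordLeq_ordIso_trans ordLeq_iff_ordLess_or_ordIso
  unfolding small_def by blast

text \<open>Zorn's lemma gives a maximal \<open>G\<close>-free subset. If it were small, then by
  regularity so would be its union with all neighbourhoods of its points, and a point of
  \<open>P\<close> outside that union could still be added.\<close>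

lemma independent_set:
  assumes P: "\<not> small P"
    and nb: "\<And>\<alpha>. \<alpha> \<in> P \<Longrightarrow> small {\<beta> \<in> P. G \<alpha> \<beta> \<or> G \<beta> \<alpha>}"
    and irrefl: "\<And>\<alpha>. \<alpha> \<in> P \<Longrightarrow> \<not> G \<alpha> \<alpha>"
  obtains Q where "Q \<subseteq> P" "\<not> small Q" "\<And>\<alpha> \<beta>. \<lbrakk>\<alpha> \<in> Q; \<beta> \<in> Q\<rbrakk> \<Longrightarrow> \<not> G \<alpha> \<beta>"
proof -
  define \<Q> where "\<Q> = {Q. Q \<subseteq> P \<and> (\<forall>\<alpha>\<in>Q. \<forall>\<beta>\<in>Q. \<not> G \<alpha> \<beta>)}"
  have "\<exists>M\<in>\<Q>. \<forall>X\<in>\<Q>. M \<subseteq> X \<longrightarrow> X = M"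
  proof (rule subset_Zorn')
    fix C assume C: "subset.chain \<Q> C"
    have "\<not> G \<alpha> \<beta>" if ab: "\<alpha> \<in> X" "X \<in> C" "\<beta> \<in> Y" "Y \<in> C" for \<alpha> \<beta> X Y
    proof -
      have "X \<in> \<Q>" "Y \<in> \<Q>" "X \<subseteq> Y \<or> Y \<subseteq> X"
        using C ab by (auto simp: subset_chain_def)
      with ab show ?thesis
        unfolding \<Q>_def by blast
    qed
    then show "\<Union>C \<in> \<Q>"
      using C by (auto simp: \<Q>_def subset_chain_def)
  qed
  then obtain Q where Q: "Q \<in> \<Q>" and max: "\<And>X. \<lbrakk>X \<in> \<Q>; Q \<subseteq> X\<rbrakk> \<Longrightarrow> X = Q"
    by blast
  have "\<not> small Q"
  proof
    assume "small Q"
    then have "small (Q \<union> (\<Union>\<alpha>\<in>Q. {\<beta> \<in> P. G \<alpha> \<beta> \<or> G \<beta> \<alpha>}))" (is "small ?N")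
      using Q nb by (intro small_Un small_UN) (auto simp: \<Q>_def)
    then obtain \<beta> where \<beta>: "\<beta> \<in> P" "\<beta> \<notin> Q" "\<forall>\<alpha>\<in>Q. \<not> G \<alpha> \<beta> \<and> \<not> G \<beta> \<alpha>"
      using P small_mono[of ?N P] by blast
    then have "insert \<beta> Q \<in> \<Q>"
      using Q irrefl by (auto simp: \<Q>_def)
    then show False
      using max[of "insert \<beta> Q"] \<beta>(2) by blast
  qed
  with Q show thesis
    by (intro that[of Q]) (auto simp: \<Q>_def)
qed

end

section \<open>Coherent families of substitutions\<close>

lemma card_of_ordLeq_PiE:
  assumes "x\<^sub>0 \<in> \<chi>" "x\<^sub>1 \<in> \<chi>" "x\<^sub>0 \<noteq> x\<^sub>1"
  shows "|L| \<le>o |L \<rightarrow>\<^sub>E \<chi>|"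
proof -
  let ?d = "\<lambda>l. \<lambda>j\<in>L. if j = l then x\<^sub>1 else x\<^sub>0"
  have "inj_on ?d L"
  proof (rule inj_onI)
    fix l l' assume "l \<in> L" "l' \<in> L" "?d l = ?d l'"
    then have "?d l l = ?d l' l" by simp
    with \<open>l \<in> L\<close> assms(3) show "l = l'"
      by (simp split: if_splits)
  qed
  moreover have "?d ` L \<subseteq> L \<rightarrow>\<^sub>E \<chi>"
    using assms by auto
  ultimately show ?thesis
    by (auto simp: card_of_ordLeq[symmetric])
qed

text \<open>The values of the functions in \<Gamma> sort the points of \<open>B\<close> outside
  \<open>V\<close> into at most \<open>|L \<rightarrow>\<^sub>E \<chi>|\<close> fibres. Without the
  desired pair each fibre would lie in \<open>R b \<union> {b}\<close> for any of its points
  \<open>b\<close>, so \<open>B\<close> would be no larger than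
  \<open>|L \<rightarrow>\<^sub>E \<chi>|\<close>.\<close>

lemma indistinguishable_pair:
  assumes L: "infinite L" and x: "x\<^sub>0 \<in> \<chi>" "x\<^sub>1 \<in> \<chi>" "x\<^sub>0 \<noteq> x\<^sub>1"
    and B: "|L \<rightarrow>\<^sub>E \<chi>| <o |B|"
    and \<Gamma>: "|\<Gamma>| \<le>o |L|" "\<And>s b. \<lbrakk>s \<in> \<Gamma>; b \<in> B\<rbrakk> \<Longrightarrow> s b \<in> \<chi>"
    and V: "|V| \<le>o |L|"
    and R: "\<And>b. b \<in> B \<Longrightarrow> |R b| \<le>o |L|"
  obtains b b' where "b \<in> B" "b \<notin> V" "b' \<in> B" "b' \<noteq> b" "b' \<notin> R b" "\<And>s. s \<in> \<Gamma> \<Longrightarrow> s b' = s b"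
proof (rule ccontr)
  note obt = that
  assume contr: "\<not> thesis"
  let ?C = "L \<rightarrow>\<^sub>E \<chi>"
  have LC: "|L| \<le>o |?C|"
    by (rule card_of_ordLeq_PiE[OF x])
  have C: "infinite ?C"
    using LC L card_of_ordLeq_infinite by blast
  obtain j where j: "inj_on j \<Gamma>" "j ` \<Gamma> \<subseteq> L"
    using \<Gamma>(1) by (auto simp: card_of_ordLeq[symmetric])
  \<comment> \<open>The values at \<open>b\<close> of all functions in \<Gamma>, indexed through
    \<open>j\<close> by \<open>L\<close>; indices outside the range of \<open>j\<close> get the
    default \<open>x\<^sub>0\<close>, the same for every \<open>b\<close>.\<close>
  define code where "code b = (\<lambda>l\<in>L. if l \<in> j ` \<Gamma> then inv_into \<Gamma> j l b else x\<^sub>0)" for b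
  define fib where "fib u = {b \<in> B - V. code b = u}" for u
  have code: "s b = s b'" if "code b = code b'" "s \<in> \<Gamma>" for s b b'
  proof -
    have "code b (j s) = code b' (j s)" using that by simp
    then show ?thesis
      using that(2) j by (auto simp: code_def image_subset_iff inv_into_f_f)
  qed
  have fib: "|fib u| \<le>o |L|" for u
  proof (cases "fib u = {}")
    case True
    then show ?thesis by (simp add: card_of_empty)
  next
    case False
    then obtain b where b: "b \<in> B" "b \<notin> V" "code b = u"
      by (auto simp: fib_def)
    have "fib u \<subseteq> R b \<union> {b}"
    proof
      fix b' assume b': "b' \<in> fib u"
      then have "b' \<in> B" "\<And>s. s \<in> \<Gamma> \<Longrightarrow> s b' = s b"
        using b(3) code by (auto simp: fib_def)
      then show "b' \<in> R b \<union> {b}"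
        using contr obt[OF b(1,2)] by blast
    qed
    moreover have "|R b \<union> {b}| \<le>o |L|"
      using R[OF b(1)] L card_of_singl_ordLeq[of L b]
      by (intro card_of_Un_ordLeq_infinite_Field)
        (auto simp: Field_card_of card_of_card_order_on)
    ultimately show ?thesis
      using card_of_mono1 ordLeq_transitive by blast
  qed
  have img: "code ` (B - V) \<subseteq> ?C"
    using \<Gamma>(2) x(1) by (auto simp: code_def inv_into_into)
  have "|\<Union>u\<in>code ` (B - V). fib u| \<le>o |?C|"
    using card_of_mono1[OF img] fib LC ordLeq_transitive C
    by (intro card_of_UNION_ordLeq_infinite) blast+
  then have "|(\<Union>u\<in>code ` (B - V). fib u) \<union> V| \<le>o |?C|"
    using C ordLeq_transitive[OF V LC]
    by (intro card_of_Un_ordLeq_infinite_Field) (auto simp: Field_card_of card_of_card_order_on)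
  moreover have "B \<subseteq> (\<Union>u\<in>code ` (B - V). fib u) \<union> V"
    by (auto simp: fib_def)
  ultimately have "|B| \<le>o |?C|"
    using card_of_mono1 ordLeq_transitive by blast
  with B show False
    using not_ordLess_ordLeq by blast
qed

section \<open>Blocks of rapidly growing size\<close>

locale small_base = inaccessible_cardinal \<kappa> for \<kappa> :: "'k rel" +
  fixes \<chi> :: "'a set"
  assumes small_\<chi>: "small \<chi>"
    and two: "\<exists>x\<^sub>0\<in>\<chi>. \<exists>x\<^sub>1\<in>\<chi>. x\<^sub>0 \<noteq> x\<^sub>1"
    and gch: "cardSuc \<kappa> =o ctwo ^c \<kappa>"
begin

text \<open>A set of cardinality |\<alpha>| + \<omega>. The summand \<open>nat\<close> keeps it
  infinite for finite \<alpha>, so that a union of \<open>|L \<alpha>|\<close> many sets of at most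
  that size still has at most that size.\<close>

definition L :: "'k \<Rightarrow> ('k + nat) set" where
  "L \<alpha> = underS \<kappa> \<alpha> <+> (UNIV :: nat set)"

lemma infinite_L: "infinite (L \<alpha>)"
  by (simp add: L_def)

lemma Cinfinite_L: "Cinfinite |L \<alpha>|"
  by (simp add: cinfinite_def Field_card_of infinite_L card_of_card_order_on)

lemma small_L: "\<alpha> \<in> K \<Longrightarrow> small (L \<alpha>)"
  unfolding L_def by (intro small_Plus small_nat small_mono[OF small_under underS_subset_under])

lemma underS_ordLeq_L: "|underS \<kappa> \<alpha>| \<le>o |L \<alpha>|"
  unfolding L_def by (rule card_of_Plus1)

text \<open>The block of \<alpha> gets the size of the double power set of
  \<open>L \<alpha> \<times> \<chi>\<close>: one power set bounds the functions from
  \<open>L \<alpha>\<close> to \<chi>, the second makes the inequality strict, and inaccessibility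
  keeps the result small.\<close>

lemma ex_blocks:
  obtains bl where "bl \<in> K \<rightarrow> K" "\<And>\<alpha>. \<alpha> \<in> K \<Longrightarrow> small {b \<in> K. bl b = \<alpha>}"
    "\<And>\<alpha>. \<alpha> \<in> K \<Longrightarrow> |L \<alpha> \<rightarrow>\<^sub>E \<chi>| <o |{b \<in> K. bl b = \<alpha>}|"
proof -
  define B where "B \<alpha> = Pow (Pow (L \<alpha> \<times> \<chi>))" for \<alpha>
  have small_B: "small (B \<alpha>)" if "\<alpha> \<in> K" for \<alpha>
    unfolding B_def by (intro small_Pow small_Sigma small_L small_\<chi> that)
  let ?Z = "SIGMA \<alpha>:K. B \<alpha>"
  have "|?Z| \<le>o \<kappa>"
    using infinite_K Card_order ordIso_imp_ordLeq[OF card_of_K] small_B ordLess_imp_ordLeq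
    by (intro card_of_Sigma_ordLeq_infinite_Field) (auto simp: small_def)
  then have "|?Z| \<le>o |K|"
    using card_of_K ordIso_symmetric ordLeq_ordIso_trans by blast
  moreover have "|K| \<le>o |?Z|"
    by (rule surj_imp_ordLeq[of _ fst]) (force simp: B_def)
  ultimately have "|K| =o |?Z|"
    by (simp add: ordIso_iff_ordLeq)
  \<comment> \<open>The disjoint union of the candidate blocks has exactly \<kappa> elements, so it
    can be relabelled by \<open>K\<close>; \<open>fst (g b)\<close> is then the index of the block
    of \<open>b\<close>.\<close>
  then obtain g where g: "bij_betw g K ?Z"
    by (auto simp: card_of_ordIso[symmetric])
  have iso: "|{b \<in> K. fst (g b) = \<alpha>}| =o |B \<alpha>|" if "\<alpha> \<in> K" for \<alpha>
  proof (rule card_of_ordIsoI)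
    show "bij_betw (\<lambda>b. snd (g b)) {b \<in> K. fst (g b) = \<alpha>} (B \<alpha>)"
    proof (rule bij_betwI')
      fix b b' assume "b \<in> {b \<in> K. fst (g b) = \<alpha>}" "b' \<in> {b \<in> K. fst (g b) = \<alpha>}"
      then show "(snd (g b) = snd (g b')) = (b = b')"
        using g by (auto simp: bij_betw_def inj_on_def prod_eq_iff)
    next
      fix b assume "b \<in> {b \<in> K. fst (g b) = \<alpha>}"
      then have "g b \<in> ?Z" "fst (g b) = \<alpha>"
        using bij_betwE[OF g] by auto
      then show "snd (g b) \<in> B \<alpha>" by auto
    next
      fix y assume "y \<in> B \<alpha>"
      then have "(\<alpha>, y) \<in> g ` K"
        using g that by (auto simp: bij_betw_def)
      then obtain b where "b \<in> K" "g b = (\<alpha>, y)"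
        by force
      then show "\<exists>b\<in>{b \<in> K. fst (g b) = \<alpha>}. y = snd (g b)"
        by (intro bexI[of _ b]) auto
    qed
  qed
  have "|L \<alpha> \<rightarrow>\<^sub>E \<chi>| <o |B \<alpha>|" for \<alpha>
    unfolding B_def using card_of_PiE_ordLeq_Pow card_of_Pow ordLeq_ordLess_trans by blast
  then have "|L \<alpha> \<rightarrow>\<^sub>E \<chi>| <o |{b \<in> K. fst (g b) = \<alpha>}|" if "\<alpha> \<in> K" for \<alpha>
    using iso[OF that] ordIso_symmetric ordLess_ordIso_trans by blast
  moreover have "(\<lambda>b. fst (g b)) \<in> K \<rightarrow> K"
    using bij_betwE[OF g] by fastforce
  moreover have "small {b \<in> K. fst (g b) = \<alpha>}" if "\<alpha> \<in> K" for \<alpha>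
    using small_ordLeq[OF small_B[OF that]] iso[OF that] ordIso_imp_ordLeq by blast
  ultimately show thesis
    by (intro that)
qed

end

section \<open>Block-preserving maps and the extension of a family by one map\<close>

locale block_partition = small_base \<kappa> \<chi> for \<kappa> :: "'k rel" and \<chi> :: "'a set" +
  fixes bl :: "'k \<Rightarrow> 'k"
  assumes bl: "bl \<in> K \<rightarrow> K"
    and small_block: "\<alpha> \<in> K \<Longrightarrow> small {b \<in> K. bl b = \<alpha>}"
    and large_block: "\<alpha> \<in> K \<Longrightarrow> |L \<alpha> \<rightarrow>\<^sub>E \<chi>| <o |{b \<in> K. bl b = \<alpha>}|"
begin

lemma bl_in: "b \<in> K \<Longrightarrow> bl b \<in> K"
  using bl by auto

lemma small_blocks: "small X \<Longrightarrow> small {b \<in> K. bl b \<in> X}"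
proof -
  assume "small X"
  then have "small (X \<inter> K)"
    by (rule small_mono) auto
  then have "small (\<Union>\<alpha>\<in>X \<inter> K. {b \<in> K. bl b = \<alpha>})"
    by (intro small_UN small_block) auto
  then show ?thesis
    by (rule small_mono) (auto simp: bl_in)
qed

text \<open>Here \<open>t\<close> is the earlier map, made for \<open>s\<close>, and
  \<open>t'\<close> a later one. Both branches yield \<open>s (t' b) = s (t b)\<close>, so the class
  of \<open>s \<circ> t\<close> survives. The second branch also freezes the points already moved,
  which is what allows many maps to be amalgamated.\<close>

definition coherent :: "('k \<Rightarrow> 'a) \<Rightarrow> ('k \<Rightarrow> 'k) \<Rightarrow> ('k \<Rightarrow> 'k) \<Rightarrow> 'k \<Rightarrow> bool" where
  "coherent s t t' b \<longleftrightarrow> (if t b = b then s (t' b) = s b else t' b = t b)"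

text \<open>Preserving blocks makes preimages of small sets small. The bound leaves room for further
  changes: the points of block \<alpha> moved by at most |\<alpha>| + \<omega> many such maps still
  number at most |\<alpha>| + \<omega>.\<close>

definition admissible :: "('k \<Rightarrow> 'k) \<Rightarrow> bool" where
  "admissible t \<longleftrightarrow> t \<in> K \<rightarrow> K \<and> (\<forall>b\<in>K. bl (t b) = bl b) \<and>
     (\<forall>\<alpha>\<in>K. |{b \<in> K. bl b = \<alpha> \<and> t b \<noteq> b}| \<le>o |L \<alpha>| )"

definition escapes :: "'k rel \<Rightarrow> ('k \<Rightarrow> 'k) \<Rightarrow> 'k \<Rightarrow> bool" where
  "escapes R t \<alpha> \<longleftrightarrow> (\<exists>b\<in>K. bl b = \<alpha> \<and> t b \<noteq> b \<and> (b, t b) \<notin> R)"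

text \<open>In each block only few of the given maps, pairwise coherent there, are amalgamated: a
  point is moved if one of them moves it. Each map is left out in only a small set of blocks, which
  coherence up to a small set tolerates. Then one further point per suitable block is moved so as to
  escape \<open>R\<close>. As \<open>W\<close> is bounded by cardinality, limit stages of every
  cofinality are covered.\<close>

lemma extend_coherent_family:
  fixes W :: "'w set" and r :: "'w rel" and \<sigma> :: "'w \<Rightarrow> 'k \<Rightarrow> 'a" and f :: "'w \<Rightarrow> 'k \<Rightarrow> 'k"
  assumes W: "|W| \<le>o \<kappa>"
    and tot: "\<And>u v. \<lbrakk>u \<in> W; v \<in> W; u \<noteq> v\<rbrakk> \<Longrightarrow> (u, v) \<in> r \<or> (v, u) \<in> r"
    and \<sigma>: "\<And>w. w \<in> W \<Longrightarrow> \<sigma> w \<in> K \<rightarrow> \<chi>"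
    and adm: "\<And>w. w \<in> W \<Longrightarrow> admissible (f w)"
    and coh: "\<And>u v. \<lbrakk>u \<in> W; v \<in> W; (u, v) \<in> r\<rbrakk> \<Longrightarrow> small {b \<in> K. \<not> coherent (\<sigma> u) (f u) (f v) b}"
  shows "\<exists>t. admissible t \<and>
    (\<forall>\<alpha>\<in>K. (\<forall>b\<in>K. bl b = \<alpha> \<longrightarrow> |R `` {b}| \<le>o |L \<alpha>| ) \<longrightarrow> escapes R t \<alpha>) \<and>
    (\<forall>w\<in>W. small {b \<in> K. \<not> coherent (\<sigma> w) (f w) t b})"
proof -
  interpret wo: wo_rel \<kappa>
    using Card_order by (simp add: wo_rel_def card_order_on_def)
  have "|W| \<le>o |K|"
    using W card_of_K ordIso_symmetric ordLeq_ordIso_trans by blast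
  then obtain c where c: "inj_on c W" "c ` W \<subseteq> K"
    by (auto simp: card_of_ordLeq[symmetric])
  \<comment> \<open>The numbering \<open>c\<close> of \<open>W\<close> by \<open>K\<close> need not
    respect \<open>r\<close>. What counts is that its initial segments are small, so that
    exceptional blocks can be collected by regularity.\<close>
  define below where "below w = {u \<in> W. c u \<in> under \<kappa> (c w)}" for w
  \<comment> \<open>The at most \<open>|\<alpha>|\<close> many maps that are taken into account in block \<open>\<alpha>\<close>: pairwise coherent there,
    and every \<open>w\<close> is among them for almost all \<open>\<alpha>\<close>.\<close>
  define A where "A \<alpha> = {w \<in> W. c w \<in> underS \<kappa> \<alpha> \<and>
    (\<forall>u\<in>below w. \<forall>v\<in>below w. (u, v) \<in> r \<longrightarrow>
      (\<forall>b\<in>K. bl b = \<alpha> \<longrightarrow> coherent (\<sigma> u) (f u) (f v) b))}" for \<alpha>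
  have below: "u \<in> below v \<or> v \<in> below u" "u \<in> below u" if "u \<in> W" "v \<in> W" for u v
  proof -
    have "c u \<in> K" "c v \<in> K" using c(2) that by auto
    then have "(c u, c v) \<in> \<kappa> \<or> (c v, c u) \<in> \<kappa>" "(c u, c u) \<in> \<kappa>"
      using wo.TOTALS wo.REFL by (auto simp: refl_on_def)
    then show "u \<in> below v \<or> v \<in> below u" "u \<in> below u"
      using that by (auto simp: below_def under_def)
  qed
  have A_coh: "coherent (\<sigma> u) (f u) (f v) b"
    if "u \<in> A (bl b)" "v \<in> A (bl b)" "(u, v) \<in> r" "b \<in> K" for u v b
    using that below[of u v] below[of v u] unfolding A_def by blast
  \<comment> \<open>Of two maps moving \<open>b\<close>, the earlier one forces its value on the
    later. Hence the choice made in \<open>t\<^sub>0\<close> below does not matter.\<close>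
  have A_unique: "f u b = f v b"
    if "u \<in> A (bl b)" "v \<in> A (bl b)" "f u b \<noteq> b" "f v b \<noteq> b" "b \<in> K" for u v b
  proof (cases "u = v")
    case False
    then have "(u, v) \<in> r \<or> (v, u) \<in> r"
      using tot that(1,2) by (auto simp: A_def)
    then show ?thesis
      using A_coh[of u b v] A_coh[of v b u] that by (auto simp: coherent_def)
  qed simp
  have A_W: "A \<alpha> \<subseteq> W" for \<alpha>
    by (auto simp: A_def)
  have card_A: "|A \<alpha>| \<le>o |L \<alpha>|" for \<alpha>
  proof -
    have "inj_on c (A \<alpha>)" "c ` A \<alpha> \<subseteq> underS \<kappa> \<alpha>"
      using c(1) inj_on_subset[OF _ A_W] by (auto simp: A_def)
    then have "|A \<alpha>| \<le>o |underS \<kappa> \<alpha>|"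
      by (auto simp: card_of_ordLeq[symmetric])
    then show ?thesis
      using underS_ordLeq_L ordLeq_transitive by blast
  qed
  have ev_A: "small {\<alpha> \<in> K. w \<notin> A \<alpha>}" if w: "w \<in> W" for w
  proof -
    have cw: "c w \<in> K" using w c(2) by auto
    have sb: "small (below w)"
      using c(1) by (intro small_inj_on[of c, OF _ _ small_under[OF cw]])
        (auto simp: below_def inj_on_def)
    \<comment> \<open>The blocks in which some pair of maps numbered up to \<open>w\<close> fails to
      be coherent: a small union of small sets.\<close>
    define E where "E = (\<Union>u\<in>below w. \<Union>v\<in>{v \<in> below w. (u, v) \<in> r}.
      bl ` {b \<in> K. \<not> coherent (\<sigma> u) (f u) (f v) b})"
    have "small E"
      unfolding E_def
    proof (intro small_UN sb small_image coh)
      show "small {v \<in> below w. (u, v) \<in> r}" for u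
        using sb by (rule small_mono) auto
    qed (auto simp: below_def)
    then have "small (under \<kappa> (c w) \<union> E)"
      by (intro small_Un small_under cw)
    moreover have "{\<alpha> \<in> K. w \<notin> A \<alpha>} \<subseteq> under \<kappa> (c w) \<union> E"
    proof
      fix \<alpha> assume \<alpha>: "\<alpha> \<in> {\<alpha> \<in> K. w \<notin> A \<alpha>}"
      show "\<alpha> \<in> under \<kappa> (c w) \<union> E"
      proof (cases "\<alpha> \<in> under \<kappa> (c w)")
        case False
        then have "c w \<in> underS \<kappa> \<alpha>"
          using \<alpha> cw wo.TOTALS wo.REFL by (auto simp: under_def underS_def refl_on_def)
        then obtain u v b where "u \<in> below w" "v \<in> below w" "(u, v) \<in> r" "b \<in> K" "bl b = \<alpha>"
          "\<not> coherent (\<sigma> u) (f u) (f v) b"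
          using \<alpha> w unfolding A_def by blast
        then have "\<alpha> \<in> E"
          unfolding E_def by blast
        then show ?thesis by simp
      qed simp
    qed
    ultimately show ?thesis by (rule small_mono)
  qed
  define t\<^sub>0 where "t\<^sub>0 b = (if \<exists>w\<in>A (bl b). f w b \<noteq> b
    then f (SOME w. w \<in> A (bl b) \<and> f w b \<noteq> b) b else b)" for b
  have t\<^sub>0: "t\<^sub>0 b = f w b" if "w \<in> A (bl b)" "f w b \<noteq> b" "b \<in> K" for w b
  proof -
    let ?v = "SOME w. w \<in> A (bl b) \<and> f w b \<noteq> b"
    have "?v \<in> A (bl b) \<and> f ?v b \<noteq> b"
      by (rule someI) (use that in blast)
    then show ?thesis
      using A_unique[of ?v b w] that unfolding t\<^sub>0_def by auto
  qed
  have t\<^sub>0_cases: "t\<^sub>0 b = b \<or> (\<exists>w\<in>A (bl b). f w b \<noteq> b \<and> t\<^sub>0 b = f w b)" if "b \<in> K" for b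
    using t\<^sub>0[of _ b] that unfolding t\<^sub>0_def by metis
  have t\<^sub>0_coh: "coherent (\<sigma> w) (f w) t\<^sub>0 b" if w: "w \<in> A (bl b)" and b: "b \<in> K" for w b
  proof (cases "f w b = b")
    case True
    show ?thesis
    proof (cases "t\<^sub>0 b = b")
      \<comment> \<open>A map \<open>v\<close> moving \<open>b\<close> cannot precede
        \<open>w\<close>, since then \<open>w\<close> would move \<open>b\<close> too. So
        \<open>w\<close> precedes \<open>v\<close>, and \<open>v\<close> moves \<open>b\<close>
        within a level set of \<open>\<sigma> w\<close>.\<close>
      case False
      then obtain v where v: "v \<in> A (bl b)" "f v b \<noteq> b" "t\<^sub>0 b = f v b"
        using t\<^sub>0_cases[OF b] by blast
      then have "v \<noteq> w" using True by auto
      then have "(v, w) \<in> r \<or> (w, v) \<in> r"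
        using tot v(1) w A_W by blast
      then show ?thesis
        using A_coh[of v b w] A_coh[of w b v] v w b True by (auto simp: coherent_def)
    qed (simp add: coherent_def True)
  qed (use t\<^sub>0[OF w _ b] in \<open>simp add: coherent_def\<close>)
  define V where "V \<alpha> = {b \<in> K. bl b = \<alpha> \<and> t\<^sub>0 b \<noteq> b}" for \<alpha>
  have card_V: "|V \<alpha>| \<le>o |L \<alpha>|" if "\<alpha> \<in> K" for \<alpha>
  proof -
    have "|\<Union>w\<in>A \<alpha>. {b \<in> K. bl b = \<alpha> \<and> f w b \<noteq> b}| \<le>o |L \<alpha>|"
      using card_A adm A_W that infinite_L unfolding admissible_def
      by (intro card_of_UNION_ordLeq_infinite) blast+
    moreover have "V \<alpha> \<subseteq> (\<Union>w\<in>A \<alpha>. {b \<in> K. bl b = \<alpha> \<and> f w b \<noteq> b})"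
      using t\<^sub>0_cases by (auto simp: V_def)
    ultimately show ?thesis
      using card_of_mono1 ordLeq_transitive by blast
  qed
  obtain x\<^sub>0 x\<^sub>1 where x: "x\<^sub>0 \<in> \<chi>" "x\<^sub>1 \<in> \<chi>" "x\<^sub>0 \<noteq> x\<^sub>1"
    using two by blast
  define ok where "ok \<alpha> \<longleftrightarrow> \<alpha> \<in> K \<and> (\<forall>b\<in>K. bl b = \<alpha> \<longrightarrow> |R `` {b}| \<le>o |L \<alpha>| )" for \<alpha>
  \<comment> \<open>The functions \<open>\<sigma> w\<close> in play number at most
    \<open>|L \<alpha>|\<close>, so counting yields a point fixed by \<open>t\<^sub>0\<close> and a
    target outside \<open>R\<close> that none of these functions distinguishes from it.\<close>
  have "\<exists>b b'. b \<in> K \<and> bl b = \<alpha> \<and> b \<notin> V \<alpha> \<and> b' \<in> K \<and> bl b' = \<alpha> \<and> b' \<noteq> b \<and> (b, b') \<notin> R \<and>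
    (\<forall>w\<in>A \<alpha>. \<sigma> w b' = \<sigma> w b)" if "ok \<alpha>" for \<alpha>
  proof -
    have \<alpha>: "\<alpha> \<in> K" using that by (simp add: ok_def)
    have \<Gamma>: "|\<sigma> ` A \<alpha>| \<le>o |L \<alpha>|"
      using card_of_image card_A ordLeq_transitive by blast
    have \<Gamma>_\<chi>: "s b \<in> \<chi>" if "s \<in> \<sigma> ` A \<alpha>" "b \<in> {b \<in> K. bl b = \<alpha>}" for s b
      using that \<sigma> A_W by blast
    have R: "|R `` {b}| \<le>o |L \<alpha>|" if "b \<in> {b \<in> K. bl b = \<alpha>}" for b
      using that \<open>ok \<alpha>\<close> by (simp add: ok_def)
    show ?thesis
    proof (rule indistinguishable_pair[where R = "\<lambda>b. R `` {b}",
          OF infinite_L x large_block[OF \<alpha>] \<Gamma> _ card_V[OF \<alpha>] R])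
      fix b b' assume "b \<in> {b \<in> K. bl b = \<alpha>}" "b \<notin> V \<alpha>" "b' \<in> {b \<in> K. bl b = \<alpha>}"
        "b' \<noteq> b" "b' \<notin> R `` {b}" "\<And>s. s \<in> \<sigma> ` A \<alpha> \<Longrightarrow> s b' = s b"
      then show ?thesis
        by (intro exI[of _ b] exI[of _ b']) auto
    qed (use \<Gamma>_\<chi> in auto)
  qed
  then obtain p p' where p: "\<And>\<alpha>. ok \<alpha> \<Longrightarrow> p \<alpha> \<in> K \<and> bl (p \<alpha>) = \<alpha> \<and> p \<alpha> \<notin> V \<alpha> \<and> p' \<alpha> \<in> K \<and>
      bl (p' \<alpha>) = \<alpha> \<and> p' \<alpha> \<noteq> p \<alpha> \<and> (p \<alpha>, p' \<alpha>) \<notin> R \<and> (\<forall>w\<in>A \<alpha>. \<sigma> w (p' \<alpha>) = \<sigma> w (p \<alpha>))"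
    by metis
  \<comment> \<open>Redirecting \<open>p \<alpha>\<close> preserves coherence: it is fixed by every
    map in \<open>A \<alpha>\<close>, and all the functions in play agree at
    \<open>p \<alpha>\<close> and \<open>p' \<alpha>\<close>.\<close>
  define t where "t b = (if ok (bl b) \<and> b = p (bl b) then p' (bl b) else t\<^sub>0 b)" for b
  have t_K: "t b \<in> K \<and> bl (t b) = bl b" if "b \<in> K" for b
  proof -
    have "t\<^sub>0 b \<in> K \<and> bl (t\<^sub>0 b) = bl b"
      using t\<^sub>0_cases[OF that] adm A_W that unfolding admissible_def by fastforce
    then show ?thesis
      using p[of "bl b"] by (auto simp: t_def)
  qed
  have "|{b \<in> K. bl b = \<alpha> \<and> t b \<noteq> b}| \<le>o |L \<alpha>|" if "\<alpha> \<in> K" for \<alpha>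
  proof -
    have "|V \<alpha> \<union> {p \<alpha>}| \<le>o |L \<alpha>|"
      using card_V[OF that] card_of_singl_ordLeq[OF infinite_imp_nonempty[OF infinite_L]]
      by (intro Un_Cinfinite_bound Cinfinite_L)
    moreover have "{b \<in> K. bl b = \<alpha> \<and> t b \<noteq> b} \<subseteq> V \<alpha> \<union> {p \<alpha>}"
      by (auto simp: t_def V_def)
    ultimately show ?thesis
      using card_of_mono1 ordLeq_transitive by blast
  qed
  then have "admissible t"
    using t_K by (auto simp: admissible_def)
  moreover have "escapes R t \<alpha>" if "ok \<alpha>" for \<alpha>
    unfolding escapes_def using p[OF that] that by (intro bexI[of _ "p \<alpha>"]) (auto simp: t_def)
  moreover have "small {b \<in> K. \<not> coherent (\<sigma> w) (f w) t b}" if w: "w \<in> W" for w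
  proof -
    have "coherent (\<sigma> w) (f w) t b" if b: "b \<in> K" "w \<in> A (bl b)" for b
    proof (cases "ok (bl b) \<and> b = p (bl b)")
      case True
      then have "t\<^sub>0 b = b"
        using p[of "bl b"] b(1) by (auto simp: V_def)
      then have "f w b = b"
        using t\<^sub>0[OF b(2) _ b(1)] by auto
      then show ?thesis
        using True p[of "bl b"] b(2) by (auto simp: coherent_def t_def)
    next
      case False
      then show ?thesis
        using t\<^sub>0_coh[OF b(2,1)] by (auto simp: coherent_def t_def)
    qed
    then have "{b \<in> K. \<not> coherent (\<sigma> w) (f w) t b} \<subseteq> {b \<in> K. bl b \<in> {\<alpha> \<in> K. w \<notin> A \<alpha>}}"
      using bl_in by auto
    then show ?thesis
      using small_mono[OF small_blocks[OF ev_A[OF w]]] by blast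
  qed
  ultimately show ?thesis
    unfolding ok_def by blast
qed

end

section \<open>The recursion over all pairs of a function and a relation\<close>

context small_base
begin

text \<open>
  The stage \<open>(s, R)\<close> of the recursion treats the function \<open>s\<close> and avoids the relation \<open>R\<close>.
\<close>

definition tasks :: "(('k \<Rightarrow> 'a) \<times> 'k rel) set" where
  "tasks = (K \<rightarrow>\<^sub>E \<chi>) \<times> Pow (K \<times> K)"

text \<open>The hypothesis \<kappa>^+ = 2^\<kappa> enters here: it bounds the number of tasks so
  that every stage has at most \<kappa> predecessors.\<close>

lemma Pow_ordLeq_cardSuc:
  assumes "|X| \<le>o \<kappa>"
  shows "|Pow X| \<le>o cardSuc \<kappa>"
proof -
  have "|X| \<le>o |K|"
    using assms card_of_K ordIso_symmetric ordLeq_ordIso_trans by blast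
  then have "|Pow X| \<le>o |Pow K|"
    by (rule card_of_Pow_mono)
  moreover have "|Pow K| =o ctwo ^c \<kappa>"
    unfolding cexp_def ctwo_def Field_card_of by (rule card_of_Pow_Func)
  ultimately have "|Pow X| \<le>o ctwo ^c \<kappa>"
    using ordLeq_ordIso_trans by blast
  then show ?thesis
    using gch ordIso_symmetric ordLeq_ordIso_trans by blast
qed

lemma card_of_tasks: "|tasks| \<le>o cardSuc \<kappa>"
proof -
  have \<kappa>: "|K| \<le>o \<kappa>"
    using card_of_K ordIso_imp_ordLeq by blast
  have "|K \<times> \<chi>| \<le>o \<kappa>" "|K \<times> K| \<le>o \<kappa>"
    using \<kappa> small_\<chi> ordLess_imp_ordLeq infinite_K Card_order
    by (auto intro!: card_of_Times_ordLeq_infinite_Field simp: small_def)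
  then have "|Pow (K \<times> \<chi>)| \<le>o cardSuc \<kappa>" "|Pow (K \<times> K)| \<le>o cardSuc \<kappa>"
    by (auto intro: Pow_ordLeq_cardSuc)
  moreover have "|K \<rightarrow>\<^sub>E \<chi>| \<le>o |Pow (K \<times> \<chi>)|"
    by (rule card_of_PiE_ordLeq_Pow)
  ultimately show ?thesis
    unfolding tasks_def using Cinfinite_cardSuc[OF Cinfinite] ordLeq_transitive
    by (intro card_of_Times_ordLeq_infinite_Field) (auto simp: cinfinite_def)
qed

text \<open>Proper initial segments of a cardinal order of size at most \<kappa>^+ have at most
  \<kappa> elements. For \<open>x\<close> outside \<open>tasks\<close> the segment is empty, so the
  recursion can run over the whole type.\<close>

lemma card_of_underS_tasks: "|underS |tasks| x| \<le>o \<kappa>"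
proof (cases "x \<in> tasks")
  case True
  then have "|underS |tasks| x| <o |tasks|"
    by (intro card_of_underS) (simp_all add: card_of_card_order_on Field_card_of)
  then have "|underS |tasks| x| <o cardSuc \<kappa>"
    using card_of_tasks ordLess_ordLeq_trans by blast
  then show ?thesis
    using cardSuc_ordLeq_ordLess[OF Card_order card_of_Card_order] by blast
next
  case False
  then have "underS |tasks| x = {}"
    by (auto simp: underS_def) (metis FieldI2 Field_card_of)
  then show ?thesis
    using Card_order_empty[OF Card_order] by simp
qed

text \<open>The cardinality of \<open>N\<close> is that of an initial segment
  \<open>underS \<kappa> a\<close>, and from \<open>a\<close> on every \<open>L \<alpha>\<close> is
  at least that large.\<close>

lemma eventually_ordLeq_L:
  assumes "small N"
  shows "small {\<alpha> \<in> K. \<not> |N| \<le>o |L \<alpha>|}"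
proof -
  interpret wo: wo_rel \<kappa>
    using Card_order by (simp add: wo_rel_def card_order_on_def)
  obtain a where a: "a \<in> K" "|N| =o Restr \<kappa> (underS \<kappa> a)"
    using assms ordLess_iff_ordIso_Restr[OF wo.WELL card_of_Well_order[of N]]
    by (auto simp: small_def)
  have "Field (Restr \<kappa> (underS \<kappa> a)) = underS \<kappa> a"
    by (intro Refl_Field_Restr2 wo.REFL subsetI) (rule underS_Field)
  then have N: "|N| =o |underS \<kappa> a|"
    using card_of_cong[OF a(2)] by (simp add: Field_card_of)
  have "|N| \<le>o |L \<alpha>|" if \<alpha>: "\<alpha> \<in> K" "\<alpha> \<notin> under \<kappa> a" for \<alpha>
  proof -
    have "(a, \<alpha>) \<in> \<kappa>"
      using \<alpha> a(1) wo.TOTALS by (auto simp: under_def)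
    then have "|underS \<kappa> a| \<le>o |underS \<kappa> \<alpha>|"
      by (intro card_of_mono1 underS_incr wo.TRANS wo.ANTISYM)
    then show ?thesis
      using N underS_ordLeq_L ordIso_ordLeq_trans ordLeq_transitive by blast
  qed
  then show ?thesis
    by (intro small_mono[OF small_under[OF a(1)]]) auto
qed

end

text \<open>Well-founded recursion along \<open>|tasks|\<close>: each stage is an instance of
  \<open>extend_coherent_family\<close>, with the maps of all its predecessors as the given
  family.\<close>

lemma (in block_partition) coherent_maps:
  obtains \<theta> where "\<And>x. admissible (\<theta> x)"
    "\<And>x \<alpha>. \<lbrakk>\<alpha> \<in> K; \<forall>b\<in>K. bl b = \<alpha> \<longrightarrow> |snd x `` {b}| \<le>o |L \<alpha>|\<rbrakk> \<Longrightarrow> escapes (snd x) (\<theta> x) \<alpha>"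
    "\<And>x y. \<lbrakk>(y, x) \<in> |tasks|; y \<noteq> x\<rbrakk> \<Longrightarrow> small {b \<in> K. \<not> coherent (fst y) (\<theta> y) (\<theta> x) b}"
proof -
  interpret wo: wo_rel "|tasks|"
    by (simp add: wo_rel_def card_of_Well_order)
  define P where "P f x t \<longleftrightarrow> admissible t \<and>
    (\<forall>\<alpha>\<in>K. (\<forall>b\<in>K. bl b = \<alpha> \<longrightarrow> |snd x `` {b}| \<le>o |L \<alpha>| ) \<longrightarrow> escapes (snd x) t \<alpha>) \<and>
    (\<forall>y\<in>underS |tasks| x. small {b \<in> K. \<not> coherent (fst y) (f y) t b})" for f x t
  have "\<exists>\<theta>. \<forall>x. P \<theta> x (\<theta> x)"
  proof (rule dependent_wf_choice[OF wo.WF])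
    fix f g :: "('k \<Rightarrow> 'a) \<times> 'k rel \<Rightarrow> 'k \<Rightarrow> 'k" and x t
    assume "\<And>z. (z, x) \<in> |tasks| - Id \<Longrightarrow> f z = g z"
    then have "f y = g y" if "y \<in> underS |tasks| x" for y
      using that by (simp add: underS_def)
    then show "P f x t = P g x t"
      by (simp add: P_def)
  next
    fix f x assume IH: "\<And>y. (y, x) \<in> |tasks| - Id \<Longrightarrow> P f y (f y)"
    have IH': "P f y (f y)" if "y \<in> underS |tasks| x" for y
      using IH that by (simp add: underS_def)
    have field: "y \<in> tasks" if "y \<in> underS |tasks| x" for y
      using underS_Field[OF that] by (simp add: Field_card_of)
    show "\<exists>t. P f x t"
      unfolding P_def
    proof (rule extend_coherent_family[where r = "|tasks| - Id"])
      show "|underS |tasks| x| \<le>o \<kappa>"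
        by (rule card_of_underS_tasks)
      show "(u, v) \<in> |tasks| - Id \<or> (v, u) \<in> |tasks| - Id"
        if "u \<in> underS |tasks| x" "v \<in> underS |tasks| x" "u \<noteq> v" for u v
        using that wo.TOTALS field by (auto simp: Field_card_of)
      show "fst w \<in> K \<rightarrow> \<chi>" if "w \<in> underS |tasks| x" for w
        using field[OF that] by (auto simp: tasks_def)
      show "admissible (f w)" if "w \<in> underS |tasks| x" for w
        using IH'[OF that] by (simp add: P_def)
      show "small {b \<in> K. \<not> coherent (fst u) (f u) (f v) b}"
        if "u \<in> underS |tasks| x" "v \<in> underS |tasks| x" "(u, v) \<in> |tasks| - Id" for u v
        using IH'[OF that(2)] that(3) unfolding P_def underS_def by blast
    qed
  qed
  then obtain \<theta> where "\<And>x. P \<theta> x (\<theta> x)"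
    by blast
  then have \<theta>: "admissible (\<theta> x)"
    "\<And>\<alpha>. \<lbrakk>\<alpha> \<in> K; \<forall>b\<in>K. bl b = \<alpha> \<longrightarrow> |snd x `` {b}| \<le>o |L \<alpha>|\<rbrakk> \<Longrightarrow> escapes (snd x) (\<theta> x) \<alpha>"
    "\<And>y. \<lbrakk>(y, x) \<in> |tasks|; y \<noteq> x\<rbrakk> \<Longrightarrow> small {b \<in> K. \<not> coherent (fst y) (\<theta> y) (\<theta> x) b}" for x
    unfolding P_def underS_def by blast+
  show thesis
    by (rule that[OF \<theta>])
qed

text \<open>\<phi> composes \<open>s\<close> with the map of the stage \<open>(s, {})\<close>, and
  coherence lets any later map replace that one up to a small set. Finitely many functions therefore
  share the latest of their stages. For a relation \<open>R\<close>, the points that its stage moves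
  out of \<open>R\<close> serve all \<open>s\<close> at once: for earlier \<open>s\<close> by the
  previous remark, for later \<open>s\<close> because their maps must move these points the same
  way.\<close>

lemma (in small_base) generic_substitution:
  obtains \<phi> where
    "\<And>s. s \<in> K \<rightarrow>\<^sub>E \<chi> \<Longrightarrow> \<phi> s \<in> K \<rightarrow>\<^sub>E \<chi>"
    "\<And>S. \<lbrakk>finite S; S \<subseteq> K \<rightarrow>\<^sub>E \<chi>\<rbrakk> \<Longrightarrow> \<exists>g\<in>K \<rightarrow> K. (\<forall>s\<in>S. small {b \<in> K. \<phi> s b \<noteq> s (g b)}) \<and>
      (\<forall>X::'k set. small X \<longrightarrow> small {b \<in> K. g b \<in> X})"
    "\<And>R (N :: 'k set). \<lbrakk>R \<subseteq> K \<times> K; small N; \<forall>b\<in>K. |R `` {b}| \<le>o |N|\<rbrakk> \<Longrightarrow>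
      \<exists>D g. D \<subseteq> K \<and> \<not> small D \<and> inj_on g D \<and> (\<forall>b\<in>D. g b \<in> K \<and> (b, g b) \<notin> R) \<and>
        (\<forall>s\<in>K \<rightarrow>\<^sub>E \<chi>. small {b \<in> D. \<phi> s b \<noteq> s (g b)})"
proof -
  obtain bl where "bl \<in> K \<rightarrow> K" "\<And>\<alpha>. \<alpha> \<in> K \<Longrightarrow> small {b \<in> K. bl b = \<alpha>}"
    "\<And>\<alpha>. \<alpha> \<in> K \<Longrightarrow> |L \<alpha> \<rightarrow>\<^sub>E \<chi>| <o |{b \<in> K. bl b = \<alpha>}|"
    using ex_blocks by blast
  then interpret block_partition \<kappa> \<chi> bl
    by unfold_locales
  interpret wo: wo_rel "|tasks|"
    by (simp add: wo_rel_def card_of_Well_order)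
  obtain \<theta> where adm: "\<And>x. admissible (\<theta> x)"
    and esc: "\<And>x \<alpha>. \<lbrakk>\<alpha> \<in> K; \<forall>b\<in>K. bl b = \<alpha> \<longrightarrow> |snd x `` {b}| \<le>o |L \<alpha>|\<rbrakk> \<Longrightarrow>
      escapes (snd x) (\<theta> x) \<alpha>"
    and coh: "\<And>x y. \<lbrakk>(y, x) \<in> |tasks|; y \<noteq> x\<rbrakk> \<Longrightarrow>
      small {b \<in> K. \<not> coherent (fst y) (\<theta> y) (\<theta> x) b}"
    using coherent_maps by blast
  have \<theta>_K: "\<theta> x b \<in> K" "bl (\<theta> x b) = bl b" if "b \<in> K" for x b
    using adm[of x] that by (auto simp: admissible_def)
  define \<phi> where "\<phi> s = (\<lambda>b\<in>K. s (\<theta> (s, {}) b))" for s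
  have task: "(s, R) \<in> tasks" if "s \<in> K \<rightarrow>\<^sub>E \<chi>" "R \<subseteq> K \<times> K" for s R
    using that by (simp add: tasks_def)
  have later: "small {b \<in> K. \<phi> s b \<noteq> s (\<theta> y b)}"
    if "((s, {}), y) \<in> |tasks|" for s y
  proof (cases "(s, {}) = y")
    case True
    then show ?thesis
      by (auto simp: \<phi>_def intro: small_finite)
  next
    case False
    show ?thesis
      by (rule small_mono[OF coh[OF that False]])
        (auto simp: \<phi>_def coherent_def split: if_splits)
  qed
  obtain x\<^sub>0 where x\<^sub>0: "x\<^sub>0 \<in> \<chi>"
    using two by blast
  have const: "(\<lambda>b\<in>K. x\<^sub>0) \<in> K \<rightarrow>\<^sub>E \<chi>"
    using x\<^sub>0 by auto
  show thesis
  proof (rule that)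
    show "\<phi> s \<in> K \<rightarrow>\<^sub>E \<chi>" if "s \<in> K \<rightarrow>\<^sub>E \<chi>" for s
      using that \<theta>_K(1) by (auto simp: \<phi>_def)
  next
    fix S assume "finite S" "S \<subseteq> K \<rightarrow>\<^sub>E \<chi>"
    then have "\<exists>y\<in>tasks. \<forall>s\<in>S. ((s, {}), y) \<in> |tasks|"
    proof (induction S rule: finite_induct)
      case empty
      then show ?case
        using task[OF const, of "{}"] by auto
    next
      case (insert s S)
      then obtain y where y: "y \<in> tasks" "\<forall>s\<in>S. ((s, {}), y) \<in> |tasks|"
        by auto
      have s: "(s, {}) \<in> tasks"
        using insert.prems task by auto
      show ?case
      proof (cases "((s, {}), y) \<in> |tasks|")
        case True
        with y show ?thesis by blast
      next
        case False
        then have "(y, (s, {})) \<in> |tasks|" "((s, {}), (s, {})) \<in> |tasks|"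
          using wo.TOTALS y(1) s by (auto simp: Field_card_of)
        then show ?thesis
          using y(2) s transD[OF wo.TRANS] by blast
      qed
    qed
    then obtain y where y: "\<forall>s\<in>S. ((s, {}), y) \<in> |tasks|"
      by blast
    \<comment> \<open>Block preservation confines the preimage of \<open>X\<close> to the blocks
      meeting \<open>X\<close>.\<close>
    have "small {b \<in> K. \<theta> y b \<in> X}" if "small X" for X :: "'k set"
    proof (rule small_mono[OF small_blocks[OF small_image[OF that, of bl]]])
      show "{b \<in> K. \<theta> y b \<in> X} \<subseteq> {b \<in> K. bl b \<in> bl ` X}"
        using \<theta>_K(2)[of _ y] by (metis (mono_tags, lifting) Collect_mono imageI)
    qed
    with y later \<theta>_K(1)
    show "\<exists>g\<in>K \<rightarrow> K. (\<forall>s\<in>S. small {b \<in> K. \<phi> s b \<noteq> s (g b)}) \<and>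
      (\<forall>X::'k set. small X \<longrightarrow> small {b \<in> K. g b \<in> X})"
      by (intro bexI[of _ "\<theta> y"]) auto
  next
    fix R and N :: "'k set"
    assume R: "R \<subseteq> K \<times> K" and N: "small N" "\<forall>b\<in>K. |R `` {b}| \<le>o |N|"
    \<comment> \<open>The function component is a placeholder; any task with the relation
      \<open>R\<close> serves.\<close>
    define x where "x = ((\<lambda>b\<in>K. x\<^sub>0), R)"
    have x: "x \<in> tasks" "snd x = R"
      using task[OF const R] by (auto simp: x_def)
    define P where "P = K - {\<alpha> \<in> K. \<not> |N| \<le>o |L \<alpha>|}"
    have "\<not> small P"
    proof
      assume "small P"
      then have "small (P \<union> {\<alpha> \<in> K. \<not> |N| \<le>o |L \<alpha>|})"
        by (intro small_Un eventually_ordLeq_L N)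
      then show False
        using not_small_K small_mono[of _ K] by (auto simp: P_def)
    qed
    have "escapes R (\<theta> x) \<alpha>" if "\<alpha> \<in> P" for \<alpha>
      using esc[of \<alpha> x] N(2) that ordLeq_transitive x(2) unfolding P_def by blast
    then obtain p where p: "\<And>\<alpha>. \<alpha> \<in> P \<Longrightarrow>
        p \<alpha> \<in> K \<and> bl (p \<alpha>) = \<alpha> \<and> \<theta> x (p \<alpha>) \<noteq> p \<alpha> \<and> (p \<alpha>, \<theta> x (p \<alpha>)) \<notin> R"
      unfolding escapes_def by metis
    \<comment> \<open>There is one escaping point per block; as blocks are preserved, the map is
      injective on \<open>D\<close>.\<close>
    define D where "D = p ` P"
    have D: "b \<in> K \<and> \<theta> x b \<noteq> b \<and> (b, \<theta> x b) \<notin> R \<and> b = p (bl b)" if "b \<in> D" for b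
      using that p by (auto simp: D_def)
    have "\<not> small D"
    proof
      assume "small D"
      then have "small (bl ` D)" by (rule small_image)
      moreover have "P \<subseteq> bl ` D"
        using p by (force simp: D_def)
      ultimately show False
        using \<open>\<not> small P\<close> small_mono by blast
    qed
    moreover have "inj_on (\<theta> x) D"
    proof (rule inj_onI)
      fix b b' assume "b \<in> D" "b' \<in> D" "\<theta> x b = \<theta> x b'"
      then show "b = b'"
        using D[of b] D[of b'] \<theta>_K(2)[of b x] \<theta>_K(2)[of b' x] by metis
    qed
    moreover have "small {b \<in> D. \<phi> s b \<noteq> s (\<theta> x b)}" if s: "s \<in> K \<rightarrow>\<^sub>E \<chi>" for s
    proof (cases "((s, {}), x) \<in> |tasks|")
      case True
      show ?thesis
        by (rule small_mono[OF later[OF True]]) (use D in auto)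
    next
      \<comment> \<open>Stage \<open>x\<close> comes first. Since its map moves every point of
        \<open>D\<close>, coherence makes the later map agree with it there up to a small set,
        whatever \<open>s\<close> is.\<close>
      case False
      then have "(x, (s, {})) \<in> |tasks|" "x \<noteq> (s, {})"
        using wo.TOTALS x(1) task[OF s, of "{}"] by (auto simp: Field_card_of)
      from coh[OF this] show ?thesis
        by (rule small_mono) (use D in \<open>auto simp: \<phi>_def coherent_def split: if_splits\<close>)
    qed
    ultimately show "\<exists>D g. D \<subseteq> K \<and> \<not> small D \<and> inj_on g D \<and> (\<forall>b\<in>D. g b \<in> K \<and> (b, g b) \<notin> R) \<and>
        (\<forall>s\<in>K \<rightarrow>\<^sub>E \<chi>. small {b \<in> D. \<phi> s b \<noteq> s (g b)})"
      using D \<theta>_K(1) by (intro exI[of _ D] exI[of _ "\<theta> x"]) blast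
  qed
qed

section \<open>The projection\<close>

lemma hom_args: "\<lbrakk>h \<in> hom A B; f \<in> symbols A; xs \<in> args A f\<rbrakk> \<Longrightarrow> map h xs \<in> args B f"
  by (auto simp: hom_def args_def same_signature_def Pi_iff)

lemma hom_interp: "\<lbrakk>h \<in> hom A B; f \<in> symbols A; xs \<in> args A f\<rbrakk> \<Longrightarrow>
    h (interp A f xs) = interp B f (map h xs)"
  by (simp add: hom_def)

lemma hom_carrier: "\<lbrakk>h \<in> hom A B; x \<in> carrier A\<rbrakk> \<Longrightarrow> h x \<in> carrier B"
  by (auto simp: hom_def)

text \<open>As \<open>A\<close> is a left inverse of \<open>J\<close>, the composite
  \<open>J \<circ> A\<close> is idempotent with the same image as \<open>J\<close>, and
  \<open>A\<close> restricted to that image is the required isomorphism.\<close>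

lemma retraction_hom_projection:
  assumes A: "A \<in> End R" and J: "J \<in> End R" and AJ: "\<And>x. x \<in> carrier R \<Longrightarrow> A (J x) = x"
  shows "hom_projection R (J \<circ> A)" "isomorphic (image_alg R (J \<circ> A) R) R"
proof -
  have "J (A (interp R f xs)) = interp R f (map (J \<circ> A) xs)"
    if "f \<in> symbols R" "xs \<in> args R f" for f xs
    using that by (simp add: hom_interp[OF A] hom_interp[OF J] hom_args[OF A])
  then have "J \<circ> A \<in> End R"
    using A J by (auto simp: hom_def)
  then show "hom_projection R (J \<circ> A)"
    using AJ hom_carrier[OF A] by (simp add: hom_projection_def)
  let ?I = "image_alg R (J \<circ> A) R"
  have I: "carrier ?I \<subseteq> carrier R"
    using hom_carrier[OF A] hom_carrier[OF J] by (auto simp: image_alg_def)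
  have "A (interp R f xs) = interp R f (map A xs)"
    if "f \<in> symbols R" "xs \<in> args ?I f" for f xs
    using that I by (intro hom_interp[OF A]) (auto simp: args_def image_alg_def)
  then have "A \<in> hom ?I R"
    using I hom_carrier[OF A] by (auto simp: hom_def same_signature_def image_alg_def)
  moreover have "bij_betw A (carrier ?I) (carrier R)"
    unfolding bij_betw_def
  proof
    show "inj_on A (carrier ?I)"
      using AJ hom_carrier[OF A] by (auto simp: inj_on_def image_alg_def)
    show "A ` carrier ?I = carrier R"
    proof
      show "A ` carrier ?I \<subseteq> carrier R"
        using I hom_carrier[OF A] by blast
      show "carrier R \<subseteq> A ` carrier ?I"
      proof
        fix x assume "x \<in> carrier R"
        then have "x = A ((J \<circ> A) (J x))" "J x \<in> carrier R"
          using AJ hom_carrier[OF J] by auto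
        then show "x \<in> A ` carrier ?I"
          by (auto simp: image_alg_def)
      qed
    qed
  qed
  ultimately show "isomorphic ?I R"
    unfolding isomorphic_def by blast
qed

text \<open>Choosing representatives is harmless because \<open>f\<close> respects eventual
  equality. Operations need to be preserved only up to eventual equality, which is the form
  available for maps built from \<phi>.\<close>

lemma induced_endomorphism:
  assumes \<kappa>: "Cinfinite \<kappa>" and U: "ualgebra U"
    and f: "f \<in> carrier (power_alg U (Field \<kappa>)) \<rightarrow> carrier (power_alg U (Field \<kappa>))"
    and resp: "\<And>\<sigma> \<tau>. (\<sigma>, \<tau>) \<in> eventual_eq U \<kappa> \<Longrightarrow> (f \<sigma>, f \<tau>) \<in> eventual_eq U \<kappa>"
    and op: "\<And>g \<sigma>s. \<lbrakk>g \<in> symbols U; \<sigma>s \<in> args (power_alg U (Field \<kappa>)) g\<rbrakk> \<Longrightarrow>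
      (f (interp (power_alg U (Field \<kappa>)) g \<sigma>s), interp (power_alg U (Field \<kappa>)) g (map f \<sigma>s))
        \<in> eventual_eq U \<kappa>"
  obtains F where "F \<in> End (reduced_power U \<kappa>)"
    "\<And>\<sigma>. \<sigma> \<in> carrier (power_alg U (Field \<kappa>)) \<Longrightarrow> F (ev_class U \<kappa> \<sigma>) = ev_class U \<kappa> (f \<sigma>)"
proof -
  let ?P = "power_alg U (Field \<kappa>)" and ?R = "reduced_power U \<kappa>" and ?c = "ev_class U \<kappa>"
  have eq: "equiv (carrier ?P) (eventual_eq U \<kappa>)"
    by (rule equiv_eventual_eq[OF \<kappa>])
  have c_eq: "?c \<sigma> = ?c \<tau>" if "(\<sigma>, \<tau>) \<in> eventual_eq U \<kappa>" for \<sigma> \<tau>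
    unfolding ev_class_def using equiv_class_eq[OF eq that] .
  have c_carrier: "carrier ?R = ?c ` carrier ?P"
    by (auto simp: reduced_power_def quotient_alg_def ev_class_def quotient_def)
  have symb: "symbols ?R = symbols U" "symbols ?P = symbols U"
    and ar: "arity ?R = arity ?P"
    by (simp_all add: reduced_power_def quotient_alg_def power_alg_def)
  define F where "F X = ?c (f (SOME \<sigma>. \<sigma> \<in> X))" for X
  have F: "F (?c \<sigma>) = ?c (f \<sigma>)" if "\<sigma> \<in> carrier ?P" for \<sigma>
  proof -
    have "\<sigma> \<in> ?c \<sigma>"
      unfolding ev_class_def by (rule equiv_class_self[OF eq that])
    then have "(SOME \<sigma>'. \<sigma>' \<in> ?c \<sigma>) \<in> ?c \<sigma>"
      by (rule someI[where P = "\<lambda>\<sigma>'. \<sigma>' \<in> ?c \<sigma>"])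
    then have "(\<sigma>, SOME \<sigma>'. \<sigma>' \<in> ?c \<sigma>) \<in> eventual_eq U \<kappa>"
      by (simp add: ev_class_def)
    then show ?thesis
      unfolding F_def by (intro c_eq[symmetric] resp)
  qed
  have "F (interp ?R g Xs) = interp ?R g (map F Xs)"
    if g: "g \<in> symbols U" and Xs: "Xs \<in> args ?R g" for g Xs
  proof -
    have "\<forall>X\<in>set Xs. \<exists>\<sigma>\<in>carrier ?P. X = ?c \<sigma>"
      using Xs by (auto simp: args_def c_carrier)
    then obtain rep where rep: "\<And>X. X \<in> set Xs \<Longrightarrow> rep X \<in> carrier ?P \<and> X = ?c (rep X)"
      by metis
    define \<sigma>s where "\<sigma>s = map rep Xs"
    have Xs_eq: "Xs = map ?c \<sigma>s"
      unfolding \<sigma>s_def map_map using rep by (intro map_idI[symmetric]) auto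
    have \<sigma>s: "\<sigma>s \<in> args ?P g"
      using Xs rep by (auto simp: args_def \<sigma>s_def ar)
    have f\<sigma>s: "map f \<sigma>s \<in> args ?P g"
      using \<sigma>s f by (auto simp: args_def Pi_iff)
    have "F (interp ?R g Xs) = ?c (f (interp ?P g \<sigma>s))"
      unfolding Xs_eq interp_reduced_power[OF \<kappa> U g \<sigma>s]
      by (intro F interp_power_in_carrier[OF U g \<sigma>s])
    also have "\<dots> = ?c (interp ?P g (map f \<sigma>s))"
      by (rule c_eq[OF op[OF g \<sigma>s]])
    also have "\<dots> = interp ?R g (map ?c (map f \<sigma>s))"
      by (rule interp_reduced_power[OF \<kappa> U g f\<sigma>s, symmetric])
    also have "map ?c (map f \<sigma>s) = map F Xs"
      using \<sigma>s F by (auto simp: Xs_eq args_def)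
    finally show ?thesis .
  qed
  moreover have "F \<in> carrier ?R \<rightarrow> carrier ?R"
    using F f by (auto simp: c_carrier)
  ultimately have "F \<in> End ?R"
    by (simp add: hom_def same_signature_def symb)
  then show thesis
    using F by (rule that)
qed

section \<open>The projection built from \<phi> and an idempotent binary homomorphism\<close>

locale generic_projection = small_base \<kappa> "carrier U"
  for \<kappa> :: "'k rel" and U :: "('f, 'a) ualg" +
  fixes M :: "'a \<times> 'a \<Rightarrow> 'a" and \<phi> :: "('k \<Rightarrow> 'a) \<Rightarrow> 'k \<Rightarrow> 'a" and h :: "'k \<times> nat \<Rightarrow> 'k"
  assumes U: "ualgebra U"
    and M_hom: "M \<in> hom (prod_alg U U) U"
    and M_idem: "x \<in> carrier U \<Longrightarrow> M (x, x) = x"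
    and \<phi>_in: "s \<in> K \<rightarrow>\<^sub>E carrier U \<Longrightarrow> \<phi> s \<in> K \<rightarrow>\<^sub>E carrier U"
    and \<phi>_local: "\<lbrakk>finite S; S \<subseteq> K \<rightarrow>\<^sub>E carrier U\<rbrakk> \<Longrightarrow>
      \<exists>g\<in>K \<rightarrow> K. (\<forall>s\<in>S. small {b \<in> K. \<phi> s b \<noteq> s (g b)}) \<and>
        (\<forall>X::'k set. small X \<longrightarrow> small {b \<in> K. g b \<in> X})"
    and \<phi>_generic: "\<lbrakk>R \<subseteq> K \<times> K; small (N :: 'k set); \<forall>b\<in>K. |R `` {b}| \<le>o |N|\<rbrakk> \<Longrightarrow>
      \<exists>D g. D \<subseteq> K \<and> \<not> small D \<and> inj_on g D \<and> (\<forall>b\<in>D. g b \<in> K \<and> (b, g b) \<notin> R) \<and>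
        (\<forall>s\<in>K \<rightarrow>\<^sub>E carrier U. small {b \<in> D. \<phi> s b \<noteq> s (g b)})"
    and h: "bij_betw h (K \<times> {..<3}) K"
begin

abbreviation P :: "('f, 'k \<Rightarrow> 'a) ualg" where "P \<equiv> power_alg U K"

abbreviation eqv :: "('k \<Rightarrow> 'a) \<Rightarrow> ('k \<Rightarrow> 'a) \<Rightarrow> bool" (infix \<open>\<approx>\<close> 50) where
  "\<sigma> \<approx> \<tau> \<equiv> (\<sigma>, \<tau>) \<in> eventual_eq U \<kappa>"

lemma carrier_P: "carrier P = K \<rightarrow>\<^sub>E carrier U"
  by (simp add: power_alg_def)

lemma interp_P: "interp P f \<sigma>s = (\<lambda>z\<in>K. interp U f (map (\<lambda>\<sigma>. \<sigma> z) \<sigma>s))"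
  by (simp add: power_alg_def)

lemma args_P: "\<sigma>s \<in> args P f \<longleftrightarrow> set \<sigma>s \<subseteq> K \<rightarrow>\<^sub>E carrier U \<and> length \<sigma>s = arity U f"
  by (auto simp: args_def power_alg_def in_lists_conv_set)

lemma eqv_iff: "\<sigma> \<approx> \<tau> \<longleftrightarrow>
    \<sigma> \<in> K \<rightarrow>\<^sub>E carrier U \<and> \<tau> \<in> K \<rightarrow>\<^sub>E carrier U \<and> small {\<alpha> \<in> K. \<sigma> \<alpha> \<noteq> \<tau> \<alpha>}"
  by (simp add: eventual_eq_def carrier_P small_def)

lemma eqv_sym: "\<sigma> \<approx> \<tau> \<Longrightarrow> \<tau> \<approx> \<sigma>"
  using equiv_eventual_eq[OF Cinfinite, of U] by (meson equivE symD)

lemma eqv_trans [trans]: "\<sigma> \<approx> \<tau> \<Longrightarrow> \<tau> \<approx> \<rho> \<Longrightarrow> \<sigma> \<approx> \<rho>"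
  using equiv_eventual_eq[OF Cinfinite, of U] by (meson equivE transD)

lemma ev_class_eq_iff:
  assumes "\<sigma> \<in> K \<rightarrow>\<^sub>E carrier U" "\<tau> \<in> K \<rightarrow>\<^sub>E carrier U"
  shows "ev_class U \<kappa> \<sigma> = ev_class U \<kappa> \<tau> \<longleftrightarrow> \<sigma> \<approx> \<tau>"
  unfolding ev_class_def
  using eq_equiv_class_iff[OF equiv_eventual_eq[OF Cinfinite, of U]] assms by (simp add: carrier_P)

lemma interp_in: "\<lbrakk>f \<in> symbols U; \<sigma>s \<in> args P f\<rbrakk> \<Longrightarrow> interp P f \<sigma>s \<in> K \<rightarrow>\<^sub>E carrier U"
  using interp_power_in_carrier[OF U, of f \<sigma>s K] by (simp add: carrier_P)

lemma \<phi>_local_eqv: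
  assumes "finite S" "S \<subseteq> K \<rightarrow>\<^sub>E carrier U"
  obtains g where "g \<in> K \<rightarrow> K" "\<And>s. s \<in> S \<Longrightarrow> \<phi> s \<approx> (\<lambda>b\<in>K. s (g b))"
    "\<And>X::'k set. small X \<Longrightarrow> small {b \<in> K. g b \<in> X}"
proof -
  obtain g where g: "g \<in> K \<rightarrow> K" "\<forall>s\<in>S. small {b \<in> K. \<phi> s b \<noteq> s (g b)}"
    "\<forall>X::'k set. small X \<longrightarrow> small {b \<in> K. g b \<in> X}"
    using \<phi>_local[OF assms] by blast
  have "\<phi> s \<approx> (\<lambda>b\<in>K. s (g b))" if "s \<in> S" for s
  proof -
    have "s \<in> K \<rightarrow>\<^sub>E carrier U" using assms(2) that by blast
    moreover have "{b \<in> K. \<phi> s b \<noteq> (\<lambda>b\<in>K. s (g b)) b} = {b \<in> K. \<phi> s b \<noteq> s (g b)}"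
      by auto
    ultimately show ?thesis
      using g(1,2) that \<phi>_in[of s] by (auto simp: eqv_iff)
  qed
  with g show thesis
    by (intro that[of g]) auto
qed

text \<open>Two functions share one substitution \<open>g\<close>, and preimages under
  \<open>g\<close> of small sets, in particular of the set where the functions differ, are
  small.\<close>

lemma \<phi>_resp:
  assumes "s \<approx> t"
  shows "\<phi> s \<approx> \<phi> t"
proof -
  have st: "s \<in> K \<rightarrow>\<^sub>E carrier U" "t \<in> K \<rightarrow>\<^sub>E carrier U" "small {\<alpha> \<in> K. s \<alpha> \<noteq> t \<alpha>}"
    using assms by (auto simp: eqv_iff)
  obtain g where g: "g \<in> K \<rightarrow> K" "\<And>u. u \<in> {s, t} \<Longrightarrow> \<phi> u \<approx> (\<lambda>b\<in>K. u (g b))"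
    "\<And>X::'k set. small X \<Longrightarrow> small {b \<in> K. g b \<in> X}"
    by (rule \<phi>_local_eqv[of "{s, t}"]) (use st in auto)
  have "small {b \<in> K. (\<lambda>b\<in>K. s (g b)) b \<noteq> (\<lambda>b\<in>K. t (g b)) b}"
    by (rule small_mono[OF g(3)[OF st(3)]]) (use g(1) in auto)
  then have "(\<lambda>b\<in>K. s (g b)) \<approx> (\<lambda>b\<in>K. t (g b))"
    using st g(1) unfolding eqv_iff by (auto simp: Pi_iff)
  then show ?thesis
    using g(2)[of s] g(2)[of t] eqv_sym eqv_trans by blast
qed

text \<open>Operations are finitary, so the arguments and the value share one substitution
  \<open>g\<close>, and composing with \<open>g\<close> commutes with pointwise operations.\<close>

lemma \<phi>_op:
  assumes f: "f \<in> symbols U" and ss: "ss \<in> args P f"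
  shows "\<phi> (interp P f ss) \<approx> interp P f (map \<phi> ss)"
proof -
  have ss': "set ss \<subseteq> K \<rightarrow>\<^sub>E carrier U" "interp P f ss \<in> K \<rightarrow>\<^sub>E carrier U"
    using ss interp_in[OF f ss] by (auto simp: args_P)
  obtain g where g: "g \<in> K \<rightarrow> K"
    "\<And>u. u \<in> insert (interp P f ss) (set ss) \<Longrightarrow> \<phi> u \<approx> (\<lambda>b\<in>K. u (g b))"
    by (rule \<phi>_local_eqv[of "insert (interp P f ss) (set ss)"]) (use ss' in auto)
  let ?g = "\<lambda>u. \<lambda>b\<in>K. u (g b)"
  have "?g (interp P f ss) = interp P f (map ?g ss)"
    using g(1) by (auto simp: interp_P comp_def fun_eq_iff)
  then have "\<phi> (interp P f ss) \<approx> interp P f (map ?g ss)"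
    using g(2)[OF insertI1] by simp
  moreover have "interp P f (map \<phi> ss) \<approx> interp P f (map ?g ss)"
    using g(2) ss \<phi>_in by (intro eventual_eq_congruence[OF Cinfinite U f])
      (auto simp: args_P list_all2_conv_all_nth)
  ultimately show ?thesis
    by (rule eqv_trans[OF _ eqv_sym])
qed

section \<open>The two factors of the projection on the three copies of \<kappa>\<close>

definition A :: "('k \<Rightarrow> 'a) \<Rightarrow> 'k \<Rightarrow> 'a" where
  "A \<sigma> = (\<lambda>z\<in>K. M (\<sigma> (h (z, 0)), \<sigma> (h (z, 1))))"

definition J :: "('k \<Rightarrow> 'a) \<Rightarrow> 'k \<Rightarrow> 'a" where
  "J m = (\<lambda>k\<in>K. case inv_into (K \<times> {..<3}) h k of (z, i) \<Rightarrow> if i = 2 then \<phi> m z else m z)"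

lemma h_in: "\<lbrakk>z \<in> K; i < 3\<rbrakk> \<Longrightarrow> h (z, i) \<in> K"
  using bij_betwE[OF h] by auto

lemma h_eq_iff: "\<lbrakk>z \<in> K; i < 3; z' \<in> K; i' < 3\<rbrakk> \<Longrightarrow> h (z, i) = h (z', i') \<longleftrightarrow> z = z' \<and> i = i'"
  using h by (auto simp: bij_betw_def inj_on_def)

lemma small_h_vimage:
  assumes "small X" "i < 3"
  shows "small {b \<in> K. h (b, i) \<in> X}"
proof (rule small_inj_on)
  show "inj_on (\<lambda>b. h (b, i)) {b \<in> K. h (b, i) \<in> X}"
    using assms(2) by (auto simp: inj_on_def h_eq_iff)
qed (use assms(1) in auto)

lemma h_cases:
  assumes "k \<in> K"
  obtains z i where "z \<in> K" "i < 3" "k = h (z, i)"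
proof -
  have "k \<in> h ` (K \<times> {..<3})"
    using h assms by (simp add: bij_betw_def)
  then show thesis
    using that by auto
qed

lemma J_h: "\<lbrakk>z \<in> K; i < 3\<rbrakk> \<Longrightarrow> J m (h (z, i)) = (if i = 2 then \<phi> m z else m z)"
  using h by (simp add: J_def h_in bij_betw_def inv_into_f_f)

lemma M_in: "\<lbrakk>x \<in> carrier U; y \<in> carrier U\<rbrakk> \<Longrightarrow> M (x, y) \<in> carrier U"
  using hom_carrier[OF M_hom, of "(x, y)"] by (simp add: prod_alg_def)

lemma A_in: "\<sigma> \<in> K \<rightarrow>\<^sub>E carrier U \<Longrightarrow> A \<sigma> \<in> K \<rightarrow>\<^sub>E carrier U"
  unfolding A_def restrict_PiE_iff by (intro ballI M_in PiE_mem[of \<sigma> K] h_in) auto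

lemma J_in:
  assumes "m \<in> K \<rightarrow>\<^sub>E carrier U"
  shows "J m \<in> K \<rightarrow>\<^sub>E carrier U"
proof
  fix k assume "k \<in> K"
  then obtain z i where "z \<in> K" "i < 3" "k = h (z, i)"
    by (rule h_cases)
  then show "J m k \<in> carrier U"
    using assms \<phi>_in[OF assms] by (auto simp: J_h)
qed (simp add: J_def)

lemma A_J:
  assumes "m \<in> K \<rightarrow>\<^sub>E carrier U"
  shows "A (J m) = m"
proof
  show "A (J m) z = m z" for z
    using assms M_idem by (cases "z \<in> K") (auto simp: A_def J_h)
qed

lemma A_resp:
  assumes "\<sigma> \<approx> \<tau>"
  shows "A \<sigma> \<approx> A \<tau>"
proof -
  let ?D = "{k \<in> K. \<sigma> k \<noteq> \<tau> k}"
  have "small ({z \<in> K. h (z, 0) \<in> ?D} \<union> {z \<in> K. h (z, 1) \<in> ?D})"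
    using assms by (intro small_Un small_h_vimage) (auto simp: eqv_iff)
  moreover have "{z \<in> K. A \<sigma> z \<noteq> A \<tau> z} \<subseteq> {z \<in> K. h (z, 0) \<in> ?D} \<union> {z \<in> K. h (z, 1) \<in> ?D}"
    by (auto simp: A_def h_in)
  ultimately have "small {z \<in> K. A \<sigma> z \<noteq> A \<tau> z}"
    by (rule small_mono)
  then show ?thesis
    using assms by (simp add: eqv_iff A_in)
qed

lemma A_op:
  assumes f: "f \<in> symbols U" and \<sigma>s: "\<sigma>s \<in> args P f"
  shows "A (interp P f \<sigma>s) = interp P f (map A \<sigma>s)"
proof
  fix z
  show "A (interp P f \<sigma>s) z = interp P f (map A \<sigma>s) z"
  proof (cases "z \<in> K")
    case True
    let ?ps = "map (\<lambda>\<sigma>. (\<sigma> (h (z, 0)), \<sigma> (h (z, 1)))) \<sigma>s"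
    have "?ps \<in> args (prod_alg U U) f"
    proof -
      have "\<sigma> (h (z, i)) \<in> carrier U" if "\<sigma> \<in> set \<sigma>s" "i < 3" for \<sigma> i
        using \<sigma>s that True by (intro PiE_mem[of \<sigma> K] h_in) (auto simp: args_P)
      then show ?thesis
        using \<sigma>s by (auto simp: args_def prod_alg_def power_alg_def)
    qed
    then have M: "M (interp (prod_alg U U) f ?ps) = interp U f (map M ?ps)"
      using f by (intro hom_interp[OF M_hom]) (simp_all add: prod_alg_def)
    have "A (interp P f \<sigma>s) z = M (interp (prod_alg U U) f ?ps)"
      using True h_in by (simp add: A_def interp_P prod_alg_def comp_def)
    also have "\<dots> = interp P f (map A \<sigma>s) z"
      unfolding M using True by (simp add: A_def interp_P comp_def)
    finally show ?thesis .
  qed (simp add: A_def interp_P)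
qed

lemma J_resp:
  assumes "m \<approx> m'"
  shows "J m \<approx> J m'"
proof -
  let ?D = "{z \<in> K. m z \<noteq> m' z} \<union> {z \<in> K. \<phi> m z \<noteq> \<phi> m' z}"
  have "small (\<Union>i\<in>{..<3::nat}. (\<lambda>z. h (z, i)) ` ?D)"
    using assms \<phi>_resp[OF assms]
    by (intro small_UN small_image small_Un) (simp_all add: eqv_iff small_finite)
  moreover have "{k \<in> K. J m k \<noteq> J m' k} \<subseteq> (\<Union>i\<in>{..<3::nat}. (\<lambda>z. h (z, i)) ` ?D)"
  proof
    fix k assume k: "k \<in> {k \<in> K. J m k \<noteq> J m' k}"
    then obtain z i where "z \<in> K" "i < 3" "k = h (z, i)"
      using h_cases by blast
    moreover from this k have "z \<in> ?D"
      by (simp add: J_h split: if_splits)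
    ultimately show "k \<in> (\<Union>i\<in>{..<3::nat}. (\<lambda>z. h (z, i)) ` ?D)"
      by blast
  qed
  ultimately have "small {k \<in> K. J m k \<noteq> J m' k}"
    by (rule small_mono)
  then show ?thesis
    using assms by (simp add: eqv_iff J_in)
qed

text \<open>Equality is exact on copies 0 and 1; on copy 2 the only error is that of \<phi>, which
  is confined to a small set.\<close>

lemma J_op:
  assumes f: "f \<in> symbols U" and ms: "ms \<in> args P f"
  shows "J (interp P f ms) \<approx> interp P f (map J ms)"
proof -
  let ?D = "{z \<in> K. \<phi> (interp P f ms) z \<noteq> interp P f (map \<phi> ms) z}"
  have "small ((\<lambda>z. h (z, 2)) ` ?D)"
    using \<phi>_op[OF f ms] by (intro small_image) (simp add: eqv_iff)
  moreover have "{k \<in> K. J (interp P f ms) k \<noteq> interp P f (map J ms) k} \<subseteq> (\<lambda>z. h (z, 2)) ` ?D"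
  proof
    fix k assume k: "k \<in> {k \<in> K. J (interp P f ms) k \<noteq> interp P f (map J ms) k}"
    then obtain z i where zi: "z \<in> K" "i < 3" "k = h (z, i)"
      using h_cases by blast
    have "map (\<lambda>m. J m k) ms = map (\<lambda>m. if i = 2 then \<phi> m z else m z) ms"
      using zi by (simp add: J_h)
    moreover have "interp P f (map J ms) k = interp U f (map (\<lambda>m. J m k) ms)"
      using zi by (simp add: interp_P h_in comp_def)
    ultimately have J_ms: "interp P f (map J ms) k =
        interp U f (map (\<lambda>m. if i = 2 then \<phi> m z else m z) ms)"
      by (simp only:)
    have "i = 2 \<and> z \<in> ?D"
    proof (cases "i = 2")
      case True
      then have "interp P f (map J ms) k = interp P f (map \<phi> ms) z"
        using zi(1) unfolding J_ms by (simp add: interp_P comp_def)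
      then show ?thesis
        using k zi True by (simp add: J_h)
    next
      case False
      then have "interp P f (map J ms) k = interp P f ms z"
        using zi(1) unfolding J_ms by (simp add: interp_P comp_def)
      then show ?thesis
        using k zi False by (simp add: J_h)
    qed
    then show "k \<in> (\<lambda>z. h (z, 2)) ` ?D"
      using zi by blast
  qed
  ultimately have "small {k \<in> K. J (interp P f ms) k \<noteq> interp P f (map J ms) k}"
    by (rule small_mono)
  moreover have "map J ms \<in> args P f"
    using ms J_in by (auto simp: args_P)
  ultimately show ?thesis
    unfolding eqv_iff by (intro conjI J_in interp_in f ms)
qed

lemma ex_projection:
  obtains \<E> where "hom_projection (reduced_power U \<kappa>) \<E>"
    "isomorphic (image_alg (reduced_power U \<kappa>) \<E> (reduced_power U \<kappa>)) (reduced_power U \<kappa>)"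
    "\<And>\<sigma>. \<sigma> \<in> K \<rightarrow>\<^sub>E carrier U \<Longrightarrow> \<E> (ev_class U \<kappa> \<sigma>) = ev_class U \<kappa> (J (A \<sigma>))"
proof -
  obtain A' where A': "A' \<in> End (reduced_power U \<kappa>)"
    "\<And>\<sigma>. \<sigma> \<in> carrier P \<Longrightarrow> A' (ev_class U \<kappa> \<sigma>) = ev_class U \<kappa> (A \<sigma>)"
  proof (rule induced_endomorphism[OF Cinfinite U, of A])
    show "A (interp P g \<sigma>s) \<approx> interp P g (map A \<sigma>s)"
      if "g \<in> symbols U" "\<sigma>s \<in> args P g" for g \<sigma>s
    proof -
      have "A (interp P g \<sigma>s) \<in> K \<rightarrow>\<^sub>E carrier U"
        by (intro A_in interp_in that)
      then show ?thesis
        using A_op[OF that] by (simp add: eqv_iff small_finite)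
    qed
  qed (auto simp: carrier_P A_in A_resp)
  obtain J' where J': "J' \<in> End (reduced_power U \<kappa>)"
    "\<And>\<sigma>. \<sigma> \<in> carrier P \<Longrightarrow> J' (ev_class U \<kappa> \<sigma>) = ev_class U \<kappa> (J \<sigma>)"
    by (rule induced_endomorphism[OF Cinfinite U, of J]) (auto simp: carrier_P J_in J_resp J_op)
  have "A' (J' X) = X" if X: "X \<in> carrier (reduced_power U \<kappa>)" for X
  proof -
    obtain \<sigma> where \<sigma>: "\<sigma> \<in> carrier P" "X = ev_class U \<kappa> \<sigma>"
      using X by (auto simp: reduced_power_def quotient_alg_def ev_class_def quotient_def)
    then show ?thesis
      using J_in A_J by (simp add: A'(2) J'(2) carrier_P)
  qed
  note proj = retraction_hom_projection[OF A'(1) J'(1) this]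
  show thesis
    by (rule that[OF proj]) (simp_all add: A'(2) J'(2) carrier_P A_in)
qed

text \<open>Suppose almost all coordinates \<open>p\<close> had strong supports \<open>Y p\<close>
  of size at most \<mu>. Genericity of \<phi> yields \<kappa> many \<open>b\<close> for which
  coordinate \<open>h (b, 2)\<close> of \<open>\<Delta> \<sigma>\<close> should be the value of
  \<open>A \<sigma>\<close> at \<open>g b\<close>, although neither input of \<open>A\<close> at
  \<open>g b\<close> lies in the support of that coordinate. Changing the input at many such places
  at once gives a contradiction, provided that the places avoid each other's supports as
  well.\<close>

lemma no_bounded_strong_supports:
  fixes \<mu> :: "'k rel"
  assumes \<Delta>: "\<And>\<sigma>. \<sigma> \<in> K \<rightarrow>\<^sub>E carrier U \<Longrightarrow> J (A \<sigma>) \<approx> \<Delta> \<sigma>"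
    and \<mu>: "Card_order \<mu>" "\<mu> <o \<kappa>"
  shows "|{\<alpha> \<in> K. \<not> (\<exists>Y. strong_support U K (\<lambda>\<sigma>. \<Delta> \<sigma> \<alpha>) Y \<and> |Y| \<le>o \<mu>)}| =o \<kappa>"
    (is "|?bad| =o \<kappa>")
proof (rule ccontr)
  assume "\<not> |?bad| =o \<kappa>"
  then have bad: "small ?bad"
    using small_or_full[of ?bad] by auto
  define Bad where "Bad = ?bad"
  have "\<forall>p\<in>K - Bad. \<exists>Y. strong_support U K (\<lambda>\<sigma>. \<Delta> \<sigma> p) Y \<and> |Y| \<le>o \<mu>"
    by (auto simp: Bad_def)
  then obtain Y where Y: "\<And>p. p \<in> K - Bad \<Longrightarrow> strong_support U K (\<lambda>\<sigma>. \<Delta> \<sigma> p) (Y p) \<and> |Y p| \<le>o \<mu>"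
    by metis
  define touch where "touch p = {z \<in> K. h (z, 0) \<in> Y p \<or> h (z, 1) \<in> Y p}" for p
  \<comment> \<open>The pairs that \<phi> has to avoid: one of the two inputs of \<open>A\<close> at
    \<open>z\<close> lies in the support of coordinate \<open>h (b, 2)\<close>. Bad coordinates
    contribute nothing, which keeps every section within the bound \<mu>.\<close>
  define R where "R = {(b, z). b \<in> K \<and> h (b, 2) \<notin> Bad \<and> z \<in> touch (h (b, 2))}"
  have N: "small (Field \<mu>)"
    unfolding small_def by (rule ordIso_ordLess_trans[OF card_of_Field_ordIso[OF \<mu>(1)] \<mu>(2)])
  have \<mu>_N: "\<mu> =o |Field \<mu>|"
    by (rule ordIso_symmetric[OF card_of_Field_ordIso[OF \<mu>(1)]])
  have touch: "|touch p| \<le>o |Field \<mu>|" if "p \<in> K - Bad" for p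
  proof -
    have "touch p \<subseteq> (\<lambda>k. fst (inv_into (K \<times> {..<3}) h k)) ` Y p"
    proof
      fix z assume "z \<in> touch p"
      then have "\<exists>i<3. h (z, i) \<in> Y p" and z: "z \<in> K"
        by (auto simp: touch_def intro: exI[of _ 0] exI[of _ 1])
      then obtain i where i: "i < 3" "h (z, i) \<in> Y p"
        by blast
      then have "fst (inv_into (K \<times> {..<3}) h (h (z, i))) = z"
        using h z by (simp add: bij_betw_def inv_into_f_f)
      with i(2) show "z \<in> (\<lambda>k. fst (inv_into (K \<times> {..<3}) h k)) ` Y p"
        by (metis image_eqI)
    qed
    then have "|touch p| \<le>o |Y p|"
      by (rule surj_imp_ordLeq)
    then show ?thesis
      by (rule ordLeq_transitive[OF _ ordLeq_ordIso_trans[OF conjunct2[OF Y[OF that]] \<mu>_N]])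
  qed
  have R_N: "|R `` {b}| \<le>o |Field \<mu>|" if "b \<in> K" for b
  proof (cases "h (b, 2) \<in> Bad")
    case True
    then have "R `` {b} = {}" by (auto simp: R_def)
    then show ?thesis by (simp add: card_of_empty)
  next
    case False
    then have "R `` {b} = touch (h (b, 2))"
      using that by (auto simp: R_def)
    then show ?thesis
      using touch[of "h (b, 2)"] False that h_in by simp
  qed
  have R_K: "R \<subseteq> K \<times> K"
    by (auto simp: R_def touch_def)
  obtain D' g where D': "D' \<subseteq> K" "\<not> small D'" "inj_on g D'"
    "\<And>b. b \<in> D' \<Longrightarrow> g b \<in> K \<and> (b, g b) \<notin> R"
    "\<And>s. s \<in> K \<rightarrow>\<^sub>E carrier U \<Longrightarrow> small {b \<in> D'. \<phi> s b \<noteq> s (g b)}"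
    using \<phi>_generic[OF R_K N] R_N by auto
  define D where "D = {b \<in> D'. h (b, 2) \<notin> Bad}"
  have "\<not> small D"
  proof
    assume "small D"
    then have "small (D \<union> {b \<in> K. h (b, 2) \<in> Bad})"
      using bad by (intro small_Un small_h_vimage) (auto simp: Bad_def)
    then have "small D'"
      by (rule small_mono) (use D'(1) in \<open>auto simp: D_def\<close>)
    with D'(2) show False ..
  qed
  have D: "b \<in> K" "h (b, 2) \<in> K - Bad" "g b \<in> K" "g b \<notin> touch (h (b, 2))" if "b \<in> D" for b
    using that D'(1,4) h_in by (auto simp: D_def R_def)
  \<comment> \<open>Copy 2 of \<open>J (A \<sigma>)\<close> is \<phi> applied to
    \<open>A \<sigma>\<close>, which on \<open>D\<close> is evaluation at \<open>g b\<close> up to a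
    small set.\<close>
  have agree: "small {b \<in> D. \<Delta> \<sigma> (h (b, 2)) \<noteq> A \<sigma> (g b)}" if \<sigma>: "\<sigma> \<in> K \<rightarrow>\<^sub>E carrier U" for \<sigma>
  proof -
    have "small ({b \<in> K. h (b, 2) \<in> {k \<in> K. J (A \<sigma>) k \<noteq> \<Delta> \<sigma> k}} \<union> {b \<in> D'. \<phi> (A \<sigma>) b \<noteq> A \<sigma> (g b)})"
      using \<Delta>[OF \<sigma>] by (intro small_Un small_h_vimage D' A_in \<sigma>) (auto simp: eqv_iff)
    then show ?thesis
      by (rule small_mono) (use D h_in in \<open>auto simp: D_def J_h\<close>)
  qed
  obtain x\<^sub>0 x\<^sub>1 where x: "x\<^sub>0 \<in> carrier U" "x\<^sub>1 \<in> carrier U" "x\<^sub>0 \<noteq> x\<^sub>1"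
    using two by blast
  define \<sigma>\<^sub>0 where "\<sigma>\<^sub>0 = (\<lambda>k\<in>K. x\<^sub>0)"
  have \<sigma>\<^sub>0: "\<sigma>\<^sub>0 \<in> K \<rightarrow>\<^sub>E carrier U"
    using x by (auto simp: \<sigma>\<^sub>0_def)
  \<comment> \<open>Otherwise a change of \<open>\<sigma>\<^sub>0\<close> at the single point \<open>y\<close> would change \<open>\<Delta> \<sigma>\<^sub>0\<close> at \<open>\<kappa>\<close> many points.\<close>
  have thin: "small {b \<in> D. y \<in> Y (h (b, 2))}" if y: "y \<in> K" for y
  proof -
    have upd: "\<sigma>\<^sub>0(y := x) \<in> K \<rightarrow>\<^sub>E carrier U" if "x \<in> carrier U" for x
      using \<sigma>\<^sub>0 y that by (auto simp: PiE_iff extensional_def)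
    have "small {k \<in> K. \<Delta> \<sigma>\<^sub>0 k \<noteq> \<Delta> (\<sigma>\<^sub>0(y := x)) k}" if "x \<in> carrier U" for x
    proof -
      have "small {k \<in> K. \<sigma>\<^sub>0 k \<noteq> (\<sigma>\<^sub>0(y := x)) k}"
        by (rule small_mono[of "{y}"]) (auto intro: small_finite)
      then have "\<sigma>\<^sub>0 \<approx> \<sigma>\<^sub>0(y := x)"
        using \<sigma>\<^sub>0 upd[OF that] by (simp add: eqv_iff)
      then have "J (A \<sigma>\<^sub>0) \<approx> J (A (\<sigma>\<^sub>0(y := x)))"
        by (intro J_resp A_resp)
      then have "\<Delta> \<sigma>\<^sub>0 \<approx> \<Delta> (\<sigma>\<^sub>0(y := x))"
        using \<Delta>[OF \<sigma>\<^sub>0] \<Delta>[OF upd[OF that]] eqv_sym eqv_trans by blast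
      then show ?thesis
        by (simp add: eqv_iff)
    qed
    \<comment> \<open>The witness \<open>x\<close> from the strong support may vary with
      \<open>b\<close>, but there are fewer than \<kappa> values, so regularity absorbs the
      union.\<close>
    then have "small (\<Union>x\<in>carrier U. {b \<in> K. h (b, 2) \<in> {k \<in> K. \<Delta> \<sigma>\<^sub>0 k \<noteq> \<Delta> (\<sigma>\<^sub>0(y := x)) k}})"
      by (intro small_UN small_\<chi> small_h_vimage) auto
    moreover have "{b \<in> D. y \<in> Y (h (b, 2))} \<subseteq>
      (\<Union>x\<in>carrier U. {b \<in> K. h (b, 2) \<in> {k \<in> K. \<Delta> \<sigma>\<^sub>0 k \<noteq> \<Delta> (\<sigma>\<^sub>0(y := x)) k}})"
    proof
      fix b assume b: "b \<in> {b \<in> D. y \<in> Y (h (b, 2))}"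
      then have "strong_support U K (\<lambda>\<sigma>. \<Delta> \<sigma> (h (b, 2))) (Y (h (b, 2)))"
        using Y D by blast
      then obtain x where "x \<in> carrier U" "\<Delta> \<sigma>\<^sub>0 (h (b, 2)) \<noteq> \<Delta> (\<sigma>\<^sub>0(y := x)) (h (b, 2))"
        using b \<sigma>\<^sub>0 unfolding strong_support_def carrier_P by blast
      then show "b \<in> (\<Union>x\<in>carrier U. {b \<in> K. h (b, 2) \<in> {k \<in> K. \<Delta> \<sigma>\<^sub>0 k \<noteq> \<Delta> (\<sigma>\<^sub>0(y := x)) k}})"
        using b D by auto
    qed
    ultimately show ?thesis
      by (rule small_mono)
  qed
  \<comment> \<open>On an independent set \<open>Q\<close>, changing the values at all \<open>g b\<close> for \<open>b \<in> Q\<close> simultaneously is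
    invisible to \<open>\<Delta>\<close> but not to \<open>\<E>\<close>.\<close>
  define G where "G b c \<longleftrightarrow> g b \<in> touch (h (c, 2))" for b c
  obtain Q where Q: "Q \<subseteq> D" "\<not> small Q" "\<And>b c. \<lbrakk>b \<in> Q; c \<in> Q\<rbrakk> \<Longrightarrow> \<not> G b c"
  proof (rule independent_set[OF \<open>\<not> small D\<close>, of G])
    fix b assume b: "b \<in> D"
    show "\<not> G b b"
      using D(4)[OF b] by (simp add: G_def)
    \<comment> \<open>Few \<open>c\<close> have a support containing an input at \<open>g b\<close>,
      since each point lies in few supports. Few \<open>c\<close> have \<open>g c\<close> touched by
      the support belonging to \<open>b\<close>, since \<open>g\<close> is injective and that
      support is small.\<close>
    have "small ({c \<in> D. h (g b, 0) \<in> Y (h (c, 2))} \<union> {c \<in> D. h (g b, 1) \<in> Y (h (c, 2))})"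
      using D(3)[OF b] h_in by (intro small_Un thin) auto
    moreover have "small {c \<in> D. g c \<in> touch (h (b, 2))}"
    proof (rule small_inj_on[of g])
      show "inj_on g {c \<in> D. g c \<in> touch (h (b, 2))}"
        by (rule inj_on_subset[OF D'(3)]) (auto simp: D_def)
      show "small (touch (h (b, 2)))"
        using small_ordLeq[OF N touch] D(2)[OF b] by blast
    qed auto
    ultimately have "small (({c \<in> D. h (g b, 0) \<in> Y (h (c, 2))} \<union>
      {c \<in> D. h (g b, 1) \<in> Y (h (c, 2))}) \<union> {c \<in> D. g c \<in> touch (h (b, 2))})"
      by (rule small_Un)
    then show "small {c \<in> D. G b c \<or> G c b}"
      by (rule small_mono) (auto simp: G_def touch_def)
  qed auto
  \<comment> \<open>Both inputs of \<open>A\<close> at \<open>g b\<close> are changed together, so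
    that idempotence of \<open>M\<close> gives \<open>A\<close> the value \<open>x\<^sub>1\<close>
    there.\<close>
  define \<sigma>\<^sub>1 where "\<sigma>\<^sub>1 = (\<lambda>k\<in>K. if \<exists>b\<in>Q. k = h (g b, 0) \<or> k = h (g b, 1) then x\<^sub>1 else x\<^sub>0)"
  have \<sigma>\<^sub>1: "\<sigma>\<^sub>1 \<in> K \<rightarrow>\<^sub>E carrier U"
    using x by (auto simp: \<sigma>\<^sub>1_def)
  have "small ({b \<in> D. \<Delta> \<sigma>\<^sub>0 (h (b, 2)) \<noteq> A \<sigma>\<^sub>0 (g b)} \<union> {b \<in> D. \<Delta> \<sigma>\<^sub>1 (h (b, 2)) \<noteq> A \<sigma>\<^sub>1 (g b)})"
    by (intro small_Un agree \<sigma>\<^sub>0 \<sigma>\<^sub>1)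
  \<comment> \<open>The two values of \<Delta> at \<open>h (b, 2)\<close> coincide while those of
    \<open>A\<close> at \<open>g b\<close> differ, so at every \<open>b\<close> in \<open>Q\<close>
    one of the two approximations fails.\<close>
  moreover have "Q \<subseteq> {b \<in> D. \<Delta> \<sigma>\<^sub>0 (h (b, 2)) \<noteq> A \<sigma>\<^sub>0 (g b)} \<union> {b \<in> D. \<Delta> \<sigma>\<^sub>1 (h (b, 2)) \<noteq> A \<sigma>\<^sub>1 (g b)}"
  proof
    fix b assume b: "b \<in> Q"
    have bD: "b \<in> D" and gb: "g b \<in> K"
      using b Q(1) D by auto
    have supp: "strong_support U K (\<lambda>\<sigma>. \<Delta> \<sigma> (h (b, 2))) (Y (h (b, 2)))"
      using Y D(2)[OF bD] by blast
    have "restrict \<sigma>\<^sub>0 (Y (h (b, 2))) = restrict \<sigma>\<^sub>1 (Y (h (b, 2)))"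
    proof (rule restrict_ext)
      fix k assume k: "k \<in> Y (h (b, 2))"
      have "k \<noteq> h (g c, 0) \<and> k \<noteq> h (g c, 1)" if "c \<in> Q" for c
        using Q(3)[OF that b] k D(3) Q(1) that by (auto simp: G_def touch_def)
      then show "\<sigma>\<^sub>0 k = \<sigma>\<^sub>1 k"
        by (auto simp: \<sigma>\<^sub>0_def \<sigma>\<^sub>1_def)
    qed
    then have "\<Delta> \<sigma>\<^sub>0 (h (b, 2)) = \<Delta> \<sigma>\<^sub>1 (h (b, 2))"
      using supp \<sigma>\<^sub>0 \<sigma>\<^sub>1 unfolding strong_support_def carrier_P by blast
    moreover have "A \<sigma>\<^sub>0 (g b) = x\<^sub>0"
      using gb h_in x M_idem by (simp add: A_def \<sigma>\<^sub>0_def)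
    moreover have "A \<sigma>\<^sub>1 (g b) = x\<^sub>1"
    proof -
      have "\<sigma>\<^sub>1 (h (g b, 0)) = x\<^sub>1" "\<sigma>\<^sub>1 (h (g b, 1)) = x\<^sub>1"
        using b gb h_in by (auto simp: \<sigma>\<^sub>1_def)
      then show ?thesis
        using gb x M_idem by (simp add: A_def)
    qed
    ultimately show "b \<in> {b \<in> D. \<Delta> \<sigma>\<^sub>0 (h (b, 2)) \<noteq> A \<sigma>\<^sub>0 (g b)} \<union>
        {b \<in> D. \<Delta> \<sigma>\<^sub>1 (h (b, 2)) \<noteq> A \<sigma>\<^sub>1 (g b)}"
      using bD x(3) by auto
  qed
  ultimately have "small Q"
    by (rule small_mono)
  with Q(2) show False ..
qed

text \<open>With \<open>x\<^sub>2\<close> and \<open>x\<^sub>3\<close> on the first two copies,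
  \<open>A \<sigma>\<close> is the constant \<open>M (x\<^sub>2, x\<^sub>3)\<close>. Acting by a
  substitution, \<phi> fixes constants up to a small set, so \<open>J (A \<sigma>)\<close> has this
  value almost everywhere, while \<sigma> takes it nowhere.\<close>

lemma everywhere_changed:
  assumes x: "x\<^sub>2 \<in> carrier U" "x\<^sub>3 \<in> carrier U" "x\<^sub>2 \<noteq> M (x\<^sub>2, x\<^sub>3)" "M (x\<^sub>2, x\<^sub>3) \<noteq> x\<^sub>3"
  shows "\<exists>\<sigma>\<in>K \<rightarrow>\<^sub>E carrier U. \<forall>\<tau>. J (A \<sigma>) \<approx> \<tau> \<longrightarrow> small {\<alpha> \<in> K. \<sigma> \<alpha> = \<tau> \<alpha>}"
proof -
  \<comment> \<open>Copy 1 carries \<open>x\<^sub>3\<close>, copies 0 and 2 carry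
    \<open>x\<^sub>2\<close>; on copy 2 any value other than \<open>M (x\<^sub>2, x\<^sub>3)\<close>
    would do.\<close>
  define \<sigma> where "\<sigma> = (\<lambda>k\<in>K. if snd (inv_into (K \<times> {..<3}) h k) = 1 then x\<^sub>3 else x\<^sub>2)"
  let ?m = "M (x\<^sub>2, x\<^sub>3)"
  let ?c = "\<lambda>k\<in>K. ?m"
  have \<sigma>: "\<sigma> \<in> K \<rightarrow>\<^sub>E carrier U" and c: "?c \<in> K \<rightarrow>\<^sub>E carrier U"
    using x M_in by (auto simp: \<sigma>_def)
  have \<sigma>_h: "\<sigma> (h (z, i)) = (if i = 1 then x\<^sub>3 else x\<^sub>2)" if "z \<in> K" "i < 3" for z i
    using that h h_in by (simp add: \<sigma>_def bij_betw_def inv_into_f_f)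
  have A\<sigma>: "A \<sigma> = ?c"
    by (auto simp: A_def \<sigma>_h)
  obtain g where g: "g \<in> K \<rightarrow> K" "\<And>s. s \<in> {?c} \<Longrightarrow> \<phi> s \<approx> (\<lambda>b\<in>K. s (g b))"
    by (rule \<phi>_local_eqv[of "{?c}"]) (use c in auto)
  have "(\<lambda>b\<in>K. ?c (g b)) = ?c"
    using g(1) by (auto simp: fun_eq_iff)
  then have \<phi>c: "small {z \<in> K. \<phi> ?c z \<noteq> ?c z}"
    using g(2)[of ?c] by (simp add: eqv_iff)
  have "small {\<alpha> \<in> K. \<sigma> \<alpha> = \<tau> \<alpha>}" if \<tau>: "J (A \<sigma>) \<approx> \<tau>" for \<tau>
  proof -
    have "small ({k \<in> K. J ?c k \<noteq> \<tau> k} \<union> (\<lambda>z. h (z, 2)) ` {z \<in> K. \<phi> ?c z \<noteq> ?c z})"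
      using \<tau> \<phi>c by (intro small_Un small_image) (simp_all add: A\<sigma> eqv_iff)
    moreover have "{\<alpha> \<in> K. \<sigma> \<alpha> = \<tau> \<alpha>} \<subseteq>
      {k \<in> K. J ?c k \<noteq> \<tau> k} \<union> (\<lambda>z. h (z, 2)) ` {z \<in> K. \<phi> ?c z \<noteq> ?c z}"
    proof
      fix k assume k: "k \<in> {\<alpha> \<in> K. \<sigma> \<alpha> = \<tau> \<alpha>}"
      then obtain z i where zi: "z \<in> K" "i < 3" "k = h (z, i)"
        using h_cases by blast
      have "\<sigma> k \<noteq> ?m"
        using zi x(3,4) by (auto simp: \<sigma>_h)
      then have "J ?c k = \<tau> k \<Longrightarrow> i = 2 \<and> \<phi> ?c z \<noteq> ?c z"
        using k zi by (auto simp: J_h split: if_splits)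
      then show "k \<in> {k \<in> K. J ?c k \<noteq> \<tau> k} \<union> (\<lambda>z. h (z, 2)) ` {z \<in> K. \<phi> ?c z \<noteq> ?c z}"
        using k zi by blast
    qed
    ultimately show ?thesis
      by (rule small_mono)
  qed
  with \<sigma> show ?thesis by blast
qed

end

text \<open>Both halves of the theorem are instances, with \<open>M\<close> the first projection or
  the changing average. Property (3) is stated under the premise that \<open>M\<close> somewhere
  differs from both of its arguments, which the average satisfies and the first projection does
  not.\<close>

lemma ex_generic_projection:
  fixes \<kappa> :: "'k rel" and U :: "('f, 'a) ualg"
  assumes \<kappa>: "inaccessible \<kappa>" "cardSuc \<kappa> =o ctwo ^c \<kappa>"
    and U: "ualgebra U" "ctwo \<le>o |carrier U|" "|carrier U| <o \<kappa>"
    and M: "M \<in> hom (prod_alg U U) U" "\<And>x. x \<in> carrier U \<Longrightarrow> M (x, x) = x"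
  shows "\<exists>\<E>. hom_projection (reduced_power U \<kappa>) \<E> \<and>
        isomorphic (image_alg (reduced_power U \<kappa>) \<E> (reduced_power U \<kappa>)) (reduced_power U \<kappa>) \<and>
        (\<forall>\<Delta> \<in> End (power_alg U (Field \<kappa>)).
           (\<forall>\<sigma> \<in> carrier (power_alg U (Field \<kappa>)). \<E> (ev_class U \<kappa> \<sigma>) = ev_class U \<kappa> (\<Delta> \<sigma>)) \<longrightarrow>
           (\<forall>\<mu> :: 'k rel. Card_order \<mu> \<and> \<mu> <o \<kappa> \<longrightarrow>
              |{\<alpha> \<in> Field \<kappa>. \<not> (\<exists>Y. strong_support U (Field \<kappa>) (\<lambda>\<sigma>. \<Delta> \<sigma> \<alpha>) Y \<and> |Y| \<le>o \<mu>)}| =o \<kappa>)) \<and>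
        ((\<exists>x\<^sub>2 \<in> carrier U. \<exists>x\<^sub>3 \<in> carrier U. x\<^sub>2 \<noteq> M (x\<^sub>2, x\<^sub>3) \<and> M (x\<^sub>2, x\<^sub>3) \<noteq> x\<^sub>3) \<longrightarrow>
        (\<exists>\<sigma> \<in> carrier (power_alg U (Field \<kappa>)). \<forall>\<tau> \<in> carrier (power_alg U (Field \<kappa>)).
           \<E> (ev_class U \<kappa> \<sigma>) = ev_class U \<kappa> \<tau> \<longrightarrow>
           |{\<alpha> \<in> Field \<kappa>. \<sigma> \<alpha> = \<tau> \<alpha>}| <o \<kappa>))"
proof -
  interpret inaccessible_cardinal \<kappa>
    by unfold_locales (rule \<kappa>)
  have "\<exists>x\<^sub>0\<in>carrier U. \<exists>x\<^sub>1\<in>carrier U. x\<^sub>0 \<noteq> x\<^sub>1"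
  proof -
    obtain e :: "bool \<Rightarrow> 'a" where "inj e" "range e \<subseteq> carrier U"
      using U(2) unfolding ctwo_def card_of_ordLeq[symmetric] by blast
    then have "e True \<in> carrier U" "e False \<in> carrier U" "e True \<noteq> e False"
      by (auto dest: injD)
    then show ?thesis by blast
  qed
  then interpret small_base \<kappa> "carrier U"
    using \<kappa>(2) U(3) by unfold_locales (auto simp: small_def)
  have "|K \<times> {..<3::nat}| =o |K|"
    using infinite_K small_finite[of "{..<3::nat}"] not_small_K
    by (intro card_of_Times_infinite_simps)
      (auto intro: ordLess_imp_ordLeq ordLess_ordIso_trans[OF _ ordIso_symmetric[OF card_of_K]]
        simp: small_def lessThan_empty_iff)
  then obtain h where h: "bij_betw h (K \<times> {..<3::nat}) K"
    by (auto simp: card_of_ordIso[symmetric])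
  show ?thesis
  proof (rule generic_substitution)
    fix \<phi> assume
      "\<And>s. s \<in> K \<rightarrow>\<^sub>E carrier U \<Longrightarrow> \<phi> s \<in> K \<rightarrow>\<^sub>E carrier U"
      "\<And>S. \<lbrakk>finite S; S \<subseteq> K \<rightarrow>\<^sub>E carrier U\<rbrakk> \<Longrightarrow>
        \<exists>g\<in>K \<rightarrow> K. (\<forall>s\<in>S. small {b \<in> K. \<phi> s b \<noteq> s (g b)}) \<and>
          (\<forall>X::'k set. small X \<longrightarrow> small {b \<in> K. g b \<in> X})"
      "\<And>R (N :: 'k set). \<lbrakk>R \<subseteq> K \<times> K; small N; \<forall>b\<in>K. |R `` {b}| \<le>o |N|\<rbrakk> \<Longrightarrow>
        \<exists>D g. D \<subseteq> K \<and> \<not> small D \<and> inj_on g D \<and> (\<forall>b\<in>D. g b \<in> K \<and> (b, g b) \<notin> R) \<and>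
          (\<forall>s\<in>K \<rightarrow>\<^sub>E carrier U. small {b \<in> D. \<phi> s b \<noteq> s (g b)})"
    then interpret generic_projection \<kappa> U M \<phi> h
      using U(1) M h by unfold_locales
    obtain \<E> where \<E>: "hom_projection (reduced_power U \<kappa>) \<E>"
      "isomorphic (image_alg (reduced_power U \<kappa>) \<E> (reduced_power U \<kappa>)) (reduced_power U \<kappa>)"
      and \<E>_class: "\<And>\<sigma>. \<sigma> \<in> K \<rightarrow>\<^sub>E carrier U \<Longrightarrow> \<E> (ev_class U \<kappa> \<sigma>) = ev_class U \<kappa> (J (A \<sigma>))"
      using ex_projection by blast
    have \<E>_iff: "\<E> (ev_class U \<kappa> \<sigma>) = ev_class U \<kappa> \<tau> \<longleftrightarrow> J (A \<sigma>) \<approx> \<tau>"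
      if "\<sigma> \<in> K \<rightarrow>\<^sub>E carrier U" "\<tau> \<in> K \<rightarrow>\<^sub>E carrier U" for \<sigma> \<tau>
      using that \<E>_class ev_class_eq_iff J_in A_in by simp
    show ?thesis
    proof (intro exI[of _ \<E>] conjI \<E> ballI impI allI)
      fix \<Delta> and \<mu> :: "'k rel"
      assume \<Delta>: "\<Delta> \<in> End P" "\<forall>\<sigma>\<in>carrier P. \<E> (ev_class U \<kappa> \<sigma>) = ev_class U \<kappa> (\<Delta> \<sigma>)"
        and \<mu>: "Card_order \<mu> \<and> \<mu> <o \<kappa>"
      have "J (A \<sigma>) \<approx> \<Delta> \<sigma>" if "\<sigma> \<in> K \<rightarrow>\<^sub>E carrier U" for \<sigma>
        using \<Delta>(2) \<E>_iff[OF that, of "\<Delta> \<sigma>"] hom_carrier[OF \<Delta>(1)] that by (simp add: carrier_P)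
      then show "|{\<alpha> \<in> K. \<not> (\<exists>Y. strong_support U K (\<lambda>\<sigma>. \<Delta> \<sigma> \<alpha>) Y \<and> |Y| \<le>o \<mu>)}| =o \<kappa>"
        using \<mu> by (intro no_bounded_strong_supports) auto
    next
      assume "\<exists>x\<^sub>2\<in>carrier U. \<exists>x\<^sub>3\<in>carrier U. x\<^sub>2 \<noteq> M (x\<^sub>2, x\<^sub>3) \<and> M (x\<^sub>2, x\<^sub>3) \<noteq> x\<^sub>3"
      then obtain \<sigma> where "\<sigma> \<in> K \<rightarrow>\<^sub>E carrier U" "\<forall>\<tau>. J (A \<sigma>) \<approx> \<tau> \<longrightarrow> small {\<alpha> \<in> K. \<sigma> \<alpha> = \<tau> \<alpha>}"
        using everywhere_changed by blast
      then show "\<exists>\<sigma>\<in>carrier P. \<forall>\<tau>\<in>carrier P. \<E> (ev_class U \<kappa> \<sigma>) = ev_class U \<kappa> \<tau> \<longrightarrow>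
          |{\<alpha> \<in> K. \<sigma> \<alpha> = \<tau> \<alpha>}| <o \<kappa>"
        using \<E>_iff unfolding carrier_P small_def by blast
    qed
  qed
qed

theorem mainTheorem1:
  fixes \<kappa> :: "'k rel" and U :: "('f, 'a) ualg"
  assumes "inaccessible \<kappa>"
    and "cardSuc \<kappa> =o ctwo ^c \<kappa>"
    and "ualgebra U"
    and "ctwo \<le>o |carrier U|" and "|carrier U| <o \<kappa>"
  shows
    "(\<exists>\<E>. hom_projection (reduced_power U \<kappa>) \<E> \<and>
        isomorphic (image_alg (reduced_power U \<kappa>) \<E> (reduced_power U \<kappa>)) (reduced_power U \<kappa>) \<and>
        (\<forall>\<Delta> \<in> End (power_alg U (Field \<kappa>)).
           (\<forall>\<sigma> \<in> carrier (power_alg U (Field \<kappa>)). \<E> (ev_class U \<kappa> \<sigma>) = ev_class U \<kappa> (\<Delta> \<sigma>)) \<longrightarrow>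
           (\<forall>\<mu> :: 'k rel. Card_order \<mu> \<and> \<mu> <o \<kappa> \<longrightarrow>
              |{\<alpha> \<in> Field \<kappa>. \<not> (\<exists>Y. strong_support U (Field \<kappa>) (\<lambda>\<sigma>. \<Delta> \<sigma> \<alpha>) Y \<and> |Y| \<le>o \<mu>)}| =o \<kappa>)))
     \<and>
     ((\<exists>Av. changing_average U Av) \<longrightarrow>
      (\<exists>\<E>. hom_projection (reduced_power U \<kappa>) \<E> \<and>
        isomorphic (image_alg (reduced_power U \<kappa>) \<E> (reduced_power U \<kappa>)) (reduced_power U \<kappa>) \<and>
        (\<forall>\<Delta> \<in> End (power_alg U (Field \<kappa>)).
           (\<forall>\<sigma> \<in> carrier (power_alg U (Field \<kappa>)). \<E> (ev_class U \<kappa> \<sigma>) = ev_class U \<kappa> (\<Delta> \<sigma>)) \<longrightarrow>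
           (\<forall>\<mu> :: 'k rel. Card_order \<mu> \<and> \<mu> <o \<kappa> \<longrightarrow>
              |{\<alpha> \<in> Field \<kappa>. \<not> (\<exists>Y. strong_support U (Field \<kappa>) (\<lambda>\<sigma>. \<Delta> \<sigma> \<alpha>) Y \<and> |Y| \<le>o \<mu>)}| =o \<kappa>)) \<and>
        (\<exists>\<sigma> \<in> carrier (power_alg U (Field \<kappa>)). \<forall>\<tau> \<in> carrier (power_alg U (Field \<kappa>)).
           \<E> (ev_class U \<kappa> \<sigma>) = ev_class U \<kappa> \<tau> \<longrightarrow>
           |{\<alpha> \<in> Field \<kappa>. \<sigma> \<alpha> = \<tau> \<alpha>}| <o \<kappa>)))"
proof (intro conjI impI)
  \<comment> \<open>The first projection is an idempotent homomorphism for every algebra, so it can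
    play the role of \<open>M\<close> when no average is given.\<close>
  have fst_hom: "fst \<in> hom (prod_alg U U) U"
    by (auto simp: hom_def same_signature_def prod_alg_def)
  show "\<exists>\<E>. hom_projection (reduced_power U \<kappa>) \<E> \<and>
        isomorphic (image_alg (reduced_power U \<kappa>) \<E> (reduced_power U \<kappa>)) (reduced_power U \<kappa>) \<and>
        (\<forall>\<Delta> \<in> End (power_alg U (Field \<kappa>)).
           (\<forall>\<sigma> \<in> carrier (power_alg U (Field \<kappa>)). \<E> (ev_class U \<kappa> \<sigma>) = ev_class U \<kappa> (\<Delta> \<sigma>)) \<longrightarrow>
           (\<forall>\<mu> :: 'k rel. Card_order \<mu> \<and> \<mu> <o \<kappa> \<longrightarrow>
              |{\<alpha> \<in> Field \<kappa>. \<not> (\<exists>Y. strong_support U (Field \<kappa>) (\<lambda>\<sigma>. \<Delta> \<sigma> \<alpha>) Y \<and> |Y| \<le>o \<mu>)}| =o \<kappa>))"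
    using ex_generic_projection[OF assms fst_hom fst_conv] by (rule ex_forward) (elim conjE, intro conjI)
next
  assume "\<exists>Av. changing_average U Av"
  then obtain Av where Av: "Av \<in> hom (prod_alg U U) U" "\<And>x. x \<in> carrier U \<Longrightarrow> Av (x, x) = x"
    "\<exists>x\<^sub>2 \<in> carrier U. \<exists>x\<^sub>3 \<in> carrier U. x\<^sub>2 \<noteq> Av (x\<^sub>2, x\<^sub>3) \<and> Av (x\<^sub>2, x\<^sub>3) \<noteq> x\<^sub>3"
    unfolding changing_average_def by blast
  show "\<exists>\<E>. hom_projection (reduced_power U \<kappa>) \<E> \<and>
        isomorphic (image_alg (reduced_power U \<kappa>) \<E> (reduced_power U \<kappa>)) (reduced_power U \<kappa>) \<and>
        (\<forall>\<Delta> \<in> End (power_alg U (Field \<kappa>)).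
           (\<forall>\<sigma> \<in> carrier (power_alg U (Field \<kappa>)). \<E> (ev_class U \<kappa> \<sigma>) = ev_class U \<kappa> (\<Delta> \<sigma>)) \<longrightarrow>
           (\<forall>\<mu> :: 'k rel. Card_order \<mu> \<and> \<mu> <o \<kappa> \<longrightarrow>
              |{\<alpha> \<in> Field \<kappa>. \<not> (\<exists>Y. strong_support U (Field \<kappa>) (\<lambda>\<sigma>. \<Delta> \<sigma> \<alpha>) Y \<and> |Y| \<le>o \<mu>)}| =o \<kappa>)) \<and>
        (\<exists>\<sigma> \<in> carrier (power_alg U (Field \<kappa>)). \<forall>\<tau> \<in> carrier (power_alg U (Field \<kappa>)).
           \<E> (ev_class U \<kappa> \<sigma>) = ev_class U \<kappa> \<tau> \<longrightarrow>
           |{\<alpha> \<in> Field \<kappa>. \<sigma> \<alpha> = \<tau> \<alpha>}| <o \<kappa>)"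
    using ex_generic_projection[OF assms Av(1,2)] by (simp only: Av(3) simp_thms)
qed

end
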